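(* Let $(R,\mathfrak m)$ be an F-finite and F-pure local ring of characteristic $p>0$. If there is a positive integer $k$ such that $\mathrm{dfpt}(R)<k+1$ and $R_{\mathfrak p}$ is strongly F-regular for every prime $\mathfrak p$ with $\dim(R_{\mathfrak p})\le k$, then $R$ is strongly F-regular. In particular, if $\mathrm{dfpt}(R)<2$ and $R$ is normal, then $R$ is strongly F-regular.
   Context: Rings are commutative Noetherian of prime characteristic $p$. A ring is F-finite if its Frobenius map is finite; $F^e_*(R)$ is $R$ viewed as an $R$-module via the $e$-th iterate of Frobenius. An F-finite ring $R$ is F-pure if $R\to F_*(R)$ splits $R$-linearly. An F-finite domain $R$ is strongly F-regular if for every $0\neq c\in R$ there are $e>0$ and an $R$-linear map $\varphi\colon F^e_*(R)\to R$ with $\varphi(F^e_*(c))=1$. For an F-finite F-pure local ring $(R,\mathfrak m)$ and $\lambda\ge0$, the pair $(R,\mathfrak m^\lambda)$ is F-pure if for all $e\gg0$ there is $f\in\mathfrak m^{\lfloor\lambda(p^e-1)\rfloor}$ such that the $R$-linear map $R\to F^e_*(R)$, $1\mapsto F^e_*(f)$, splits; $\mathrm{fpt}(R)=\sup\{\lambda\ge 0\mid (R,\mathfrak m^\lambda)\text{ is F-pure}\}$, and $\mathrm{dfpt}(R)=\dim(R)-\mathrm{fpt}(R)$. *)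

theory Defs
  imports
    "HOL-Algebra.Polynomials"
    "HOL-Algebra.Ideal_Product"
    "HOL-Algebra.Ring_Divisibility"
    "HOL-Library.Extended_Real"
    "HOL-Computational_Algebra.Primes"
begin

section \<open>Commutative algebra\<close>

definition local_ring :: "('a, 'b) ring_scheme \<Rightarrow> 'a set \<Rightarrow> bool" where
  "local_ring R m \<longleftrightarrow>
     cring R \<and> maximalideal m R \<and> (\<forall>m'. maximalideal m' R \<longrightarrow> m' = m)"

definition has_characteristic :: "('a, 'b) ring_scheme \<Rightarrow> nat \<Rightarrow> bool" where
  "has_characteristic R p \<longleftrightarrow>
     (\<forall>n::nat. [n] \<cdot>\<^bsub>R\<^esub> \<one>\<^bsub>R\<^esub> = \<zero>\<^bsub>R\<^esub> \<longleftrightarrow> p dvd n)"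

text \<open>The supremum of the lengths of the chains of prime ideals. The zero ring, which has no
  prime ideals, gets dimension 0 here, which plays no role for local rings.\<close>

definition krull_dim :: "('a, 'b) ring_scheme \<Rightarrow> enat" where
  "krull_dim R =
     Sup {enat n | n. \<exists>P. (\<forall>i\<le>n. primeideal (P i) R) \<and> (\<forall>i<n. P i \<subset> P (Suc i))}"

text \<open>The ring of fractions with denominators in a multiplicative subset \<open>S\<close>; its elements are the
  classes \<open>fraction R S a s\<close> of pairs. The unions in the operations range over all representatives.\<close>

definition frac_rel :: "('a, 'b) ring_scheme \<Rightarrow> 'a set \<Rightarrow> (('a \<times> 'a) \<times> ('a \<times> 'a)) set" where
  "frac_rel R S = {((a, s), (b, t)). a \<in> carrier R \<and> s \<in> S \<and> b \<in> carrier R \<and> t \<in> S \<and>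
     (\<exists>u\<in>S. u \<otimes>\<^bsub>R\<^esub> (t \<otimes>\<^bsub>R\<^esub> a) = u \<otimes>\<^bsub>R\<^esub> (s \<otimes>\<^bsub>R\<^esub> b))}"

definition fraction :: "('a, 'b) ring_scheme \<Rightarrow> 'a set \<Rightarrow> 'a \<Rightarrow> 'a \<Rightarrow> ('a \<times> 'a) set" where
  "fraction R S a s = frac_rel R S `` {(a, s)}"

definition localization :: "('a, 'b) ring_scheme \<Rightarrow> 'a set \<Rightarrow> ('a \<times> 'a) set ring" where
  "localization R S =
     \<lparr> carrier = (carrier R \<times> S) // frac_rel R S,
       mult = (\<lambda>U V. \<Union>(a, s)\<in>U. \<Union>(b, t)\<in>V. fraction R S (a \<otimes>\<^bsub>R\<^esub> b) (s \<otimes>\<^bsub>R\<^esub> t)),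
       one = fraction R S \<one>\<^bsub>R\<^esub> \<one>\<^bsub>R\<^esub>,
       zero = fraction R S \<zero>\<^bsub>R\<^esub> \<one>\<^bsub>R\<^esub>,
       add = (\<lambda>U V. \<Union>(a, s)\<in>U. \<Union>(b, t)\<in>V.
                fraction R S ((t \<otimes>\<^bsub>R\<^esub> a) \<oplus>\<^bsub>R\<^esub> (s \<otimes>\<^bsub>R\<^esub> b)) (s \<otimes>\<^bsub>R\<^esub> t)) \<rparr>"

definition localization_at :: "('a, 'b) ring_scheme \<Rightarrow> 'a set \<Rightarrow> ('a \<times> 'a) set ring" where
  "localization_at R P = localization R (carrier R - P)"

definition fraction_field :: "('a, 'b) ring_scheme \<Rightarrow> ('a \<times> 'a) set ring" where
  "fraction_field D = localization D (carrier D - {\<zero>\<^bsub>D\<^esub>})"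

definition in_fraction_field :: "('a, 'b) ring_scheme \<Rightarrow> 'a \<Rightarrow> ('a \<times> 'a) set" where
  "in_fraction_field D a = fraction D (carrier D - {\<zero>\<^bsub>D\<^esub>}) a \<one>\<^bsub>D\<^esub>"

text \<open>Integrality of \<open>x\<close> over a subring \<open>A\<close> of \<open>K\<close>. Polynomials are lists of coefficients with the
  leading coefficient first; \<open>[]\<close> is the zero polynomial.\<close>

definition integral_over :: "('a, 'b) ring_scheme \<Rightarrow> 'a set \<Rightarrow> 'a \<Rightarrow> bool" where
  "integral_over K A x \<longleftrightarrow>
     (\<exists>q. polynomial\<^bsub>K\<^esub> A q \<and> q \<noteq> [] \<and> lead_coeff q = \<one>\<^bsub>K\<^esub> \<and> ring.eval K q x = \<zero>\<^bsub>K\<^esub>)"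

definition integrally_closed_domain :: "('a, 'b) ring_scheme \<Rightarrow> bool" where
  "integrally_closed_domain D \<longleftrightarrow> domain D \<and>
     (\<forall>x \<in> carrier (fraction_field D).
        integral_over (fraction_field D) (in_fraction_field D ` carrier D) x \<longrightarrow>
        x \<in> in_fraction_field D ` carrier D)"

definition normal_ring :: "('a, 'b) ring_scheme \<Rightarrow> bool" where
  "normal_ring R \<longleftrightarrow>
     cring R \<and> (\<forall>P. primeideal P R \<longrightarrow> integrally_closed_domain (localization_at R P))"

section \<open>Modules and Frobenius\<close>

definition module_hom ::
  "('a, 'b) ring_scheme \<Rightarrow> ('a, 'c, 'd) module_scheme \<Rightarrow> ('a, 'e, 'f) module_scheme \<Rightarrow> ('c \<Rightarrow> 'e) set"
  where
  "module_hom R M N = {h \<in> carrier M \<rightarrow> carrier N.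
     (\<forall>x\<in>carrier M. \<forall>y\<in>carrier M. h (x \<oplus>\<^bsub>M\<^esub> y) = h x \<oplus>\<^bsub>N\<^esub> h y) \<and>
     (\<forall>r\<in>carrier R. \<forall>x\<in>carrier M. h (r \<odot>\<^bsub>M\<^esub> x) = r \<odot>\<^bsub>N\<^esub> h x)}"

definition finitely_generated ::
  "('a, 'b) ring_scheme \<Rightarrow> ('a, 'c, 'd) module_scheme \<Rightarrow> bool" where
  "finitely_generated R M \<longleftrightarrow> (\<exists>A. finite A \<and> A \<subseteq> carrier M \<and>
     (\<forall>x\<in>carrier M. \<exists>c \<in> A \<rightarrow> carrier R. x = (\<Oplus>\<^bsub>M\<^esub>a\<in>A. c a \<odot>\<^bsub>M\<^esub> a)))"

definition splits ::
  "('a, 'b) ring_scheme \<Rightarrow> ('a, 'c, 'd) module_scheme \<Rightarrow> ('a, 'e, 'f) module_scheme \<Rightarrow> ('c \<Rightarrow> 'e) \<Rightarrow> bool"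
  where
  "splits R M N g \<longleftrightarrow> g \<in> module_hom R M N \<and>
     (\<exists>\<phi> \<in> module_hom R N M. \<forall>x\<in>carrier M. \<phi> (g x) = x)"

definition self_module :: "('a, 'b) ring_scheme \<Rightarrow> ('a, 'a) module" where
  "self_module R =
     \<lparr> carrier = carrier R, mult = mult R, one = \<one>\<^bsub>R\<^esub>, zero = \<zero>\<^bsub>R\<^esub>, add = add R,
       smult = mult R \<rparr>"

text \<open>\<open>F\<^sup>e\<^sub>*(R)\<close>, with the same elements as \<open>R\<close> (so the element \<open>F\<^sup>e\<^sub>*(x)\<close> is
  simply \<open>x\<close>) and scalar multiplication through the \<open>e\<close>-th iterate of Frobenius.\<close>

definition frobenius_module :: "nat \<Rightarrow> nat \<Rightarrow> ('a, 'b) ring_scheme \<Rightarrow> ('a, 'a) module" where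
  "frobenius_module p e R =
     \<lparr> carrier = carrier R, mult = mult R, one = \<one>\<^bsub>R\<^esub>, zero = \<zero>\<^bsub>R\<^esub>, add = add R,
       smult = (\<lambda>r x. (r [^]\<^bsub>R\<^esub> (p ^ e)) \<otimes>\<^bsub>R\<^esub> x) \<rparr>"

definition F_finite :: "nat \<Rightarrow> ('a, 'b) ring_scheme \<Rightarrow> bool" where
  "F_finite p R \<longleftrightarrow> finitely_generated R (frobenius_module p 1 R)"

definition F_pure :: "nat \<Rightarrow> ('a, 'b) ring_scheme \<Rightarrow> bool" where
  "F_pure p R \<longleftrightarrow> F_finite p R \<and>
     splits R (self_module R) (frobenius_module p 1 R) (\<lambda>r. r [^]\<^bsub>R\<^esub> p)"

definition strongly_F_regular :: "nat \<Rightarrow> ('a, 'b) ring_scheme \<Rightarrow> bool" where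
  "strongly_F_regular p R \<longleftrightarrow> domain R \<and> F_finite p R \<and>
     (\<forall>c \<in> carrier R. c \<noteq> \<zero>\<^bsub>R\<^esub> \<longrightarrow>
        (\<exists>e>0. \<exists>\<phi> \<in> module_hom R (frobenius_module p e R) (self_module R). \<phi> c = \<one>\<^bsub>R\<^esub>))"

section \<open>The F-pure threshold\<close>

text \<open>\<open>m [^] n\<close>, taken in \<open>ideals_set R\<close>, is the \<open>n\<close>-th power of the ideal \<open>m\<close>, with
  \<open>m [^] 0 = R\<close>. The map in \<open>splits\<close> is the \<open>R\<close>-linear map with \<open>1 \<mapsto> F\<^sup>e\<^sub>*(f)\<close>.\<close>

definition F_pure_pair :: "nat \<Rightarrow> ('a, 'b) ring_scheme \<Rightarrow> 'a set \<Rightarrow> real \<Rightarrow> bool" where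
  "F_pure_pair p R m l \<longleftrightarrow> (\<forall>\<^sub>F e in sequentially.
     \<exists>f \<in> m [^]\<^bsub>ideals_set R\<^esub> nat \<lfloor>l * (real p ^ e - 1)\<rfloor>.
       splits R (self_module R) (frobenius_module p e R) (\<lambda>r. r \<odot>\<^bsub>frobenius_module p e R\<^esub> f))"

definition fpt :: "nat \<Rightarrow> ('a, 'b) ring_scheme \<Rightarrow> 'a set \<Rightarrow> ereal" where
  "fpt p R m = Sup {ereal l | l. 0 \<le> l \<and> F_pure_pair p R m l}"

definition dfpt :: "nat \<Rightarrow> ('a, 'b) ring_scheme \<Rightarrow> 'a set \<Rightarrow> ereal" where
  "dfpt p R m = ereal_of_enat (krull_dim R) - fpt p R m"

end

theory Submission
  imports Defs
begin

text \<open>Let \<open>P\<close> be the splitting prime: the elements of \<open>R\<close> that every \<open>p\<^sup>-\<^sup>e\<close>-linear map sends into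
  the maximal ideal. It is prime, stable under all \<open>p\<^sup>-\<^sup>e\<close>-linear maps, and its complement consists of
  nonzerodivisors; \<open>R\<close> is strongly F-regular if and only if \<open>P = 0\<close>.

  The key inequality is \<open>fpt(R) \<le> dim(R/P)\<close>. If \<open>1 \<mapsto> F\<^sup>e\<^sub>*(f)\<close> splits, then \<open>f\<close> lies outside an
  ideal that contains \<open>P\<close> and all \<open>p\<^sup>e\<close>-th powers of elements of \<open>m\<close>; on the other hand, with
  \<open>d = dim(R/P)\<close>, polynomial growth of degree \<open>d\<close> of the lengths of \<open>R/(P + m\<^sup>M)\<close> forces
  \<open>m\<^bsup>dq+c\<^esup>\<close> into every such ideal, for \<open>q = p\<^sup>e\<close> and a constant \<open>c\<close>. Hence
  \<open>dim(R\<^sub>P) \<le> dim(R) - dim(R/P) \<le> dfpt(R) < k + 1\<close>.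

  If \<open>R\<^sub>P\<close> is strongly F-regular, a nonzero \<open>c \<in> P\<close> would be mapped to \<open>1\<close> over \<open>R\<^sub>P\<close>, and clearing
  denominators yields a map on \<open>R\<close> that moves \<open>c\<close> out of \<open>P\<close>. If \<open>R\<close> is normal and \<open>dim(R\<^sub>P) = 1\<close>,
  then \<open>P R\<^sub>P = (t)\<close>, and for a Frobenius splitting \<open>\<pi>\<close> the map \<open>x \<mapsto> t\<^sup>-\<^sup>1 \<pi>(t\<^sup>p\<^sup>-\<^sup>1 x)\<close> is defined
  because \<open>\<pi>\<close> preserves \<open>P\<close>, and it moves \<open>t\<close> out of \<open>P\<close>.\<close>

no_notation Sum_Type.Plus (infixr \<open><+>\<close> 65)

section \<open>Ideals and lengths\<close>

context cring begin

lemma idealI_cring: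
  assumes "I \<subseteq> carrier R" and "\<zero> \<in> I"
    and "\<And>x y. x \<in> I \<Longrightarrow> y \<in> I \<Longrightarrow> x \<oplus> y \<in> I"
    and mult: "\<And>r x. r \<in> carrier R \<Longrightarrow> x \<in> I \<Longrightarrow> r \<otimes> x \<in> I"
  shows "ideal I R"
proof (rule idealI[OF ring_axioms])
  show "subgroup I (add_monoid R)"
  proof (rule add.subgroupI)
    fix a assume "a \<in> I"
    moreover from this have "a \<in> carrier R" using assms(1) by blast
    moreover from this have "\<ominus> a = (\<ominus> \<one>) \<otimes> a" by algebra
    ultimately show "\<ominus> a \<in> I" using mult[of "\<ominus> \<one>" a] by simp
  qed (use assms in auto)
  show "x \<otimes> a \<in> I" if "a \<in> I" "x \<in> carrier R" for a x using that mult by blast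
  show "a \<otimes> x \<in> I" if "a \<in> I" "x \<in> carrier R" for a x
    using that mult m_comm assms(1) by (metis subsetD)
qed

lemma idealD:
  assumes "ideal I R"
  shows "I \<subseteq> carrier R" "\<zero> \<in> I"
    "x \<in> I \<Longrightarrow> y \<in> I \<Longrightarrow> x \<oplus> y \<in> I"
    "x \<in> I \<Longrightarrow> y \<in> I \<Longrightarrow> x \<ominus> y \<in> I"
    "r \<in> carrier R \<Longrightarrow> x \<in> I \<Longrightarrow> r \<otimes> x \<in> I"
    "r \<in> carrier R \<Longrightarrow> x \<in> I \<Longrightarrow> x \<otimes> r \<in> I"
proof -
  interpret I: ideal I R by fact
  show "I \<subseteq> carrier R" "\<zero> \<in> I"
    "x \<in> I \<Longrightarrow> y \<in> I \<Longrightarrow> x \<oplus> y \<in> I"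
    "x \<in> I \<Longrightarrow> y \<in> I \<Longrightarrow> x \<ominus> y \<in> I"
    "r \<in> carrier R \<Longrightarrow> x \<in> I \<Longrightarrow> r \<otimes> x \<in> I"
    "r \<in> carrier R \<Longrightarrow> x \<in> I \<Longrightarrow> x \<otimes> r \<in> I"
    using I.a_subset I.I_l_closed I.I_r_closed by (auto simp: a_minus_def)
qed

definition colon :: "'a set \<Rightarrow> 'a \<Rightarrow> 'a set" where
  "colon U b = {x \<in> carrier R. x \<otimes> b \<in> U}"

lemma colon_ideal:
  assumes "ideal U R" "b \<in> carrier R"
  shows "ideal (colon U b) R"
proof (rule idealI_cring)
  show "r \<otimes> x \<in> colon U b" if "r \<in> carrier R" "x \<in> colon U b" for r x
    using that assms idealD(5)[OF assms(1), of r "x \<otimes> b"] by (auto simp: colon_def m_assoc)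
qed (use assms idealD[OF assms(1)] in \<open>auto simp: colon_def l_distr\<close>)

definition scale :: "'a \<Rightarrow> 'a set \<Rightarrow> 'a set" where
  "scale x V = (\<lambda>v. x \<otimes> v) ` V"

lemma scale_ideal:
  assumes "ideal V R" "x \<in> carrier R"
  shows "ideal (scale x V) R"
proof (rule idealI_cring)
  show "y \<oplus> z \<in> scale x V" if yz: "y \<in> scale x V" "z \<in> scale x V" for y z
  proof -
    obtain v w where "v \<in> V" "w \<in> V" "y = x \<otimes> v" "z = x \<otimes> w" using yz unfolding scale_def by blast
    thus ?thesis using assms idealD[OF assms(1)]
      by (auto simp: scale_def r_distr subset_iff intro!: image_eqI[of _ _ "v \<oplus> w"])
  qed
  show "r \<otimes> y \<in> scale x V" if ry: "r \<in> carrier R" "y \<in> scale x V" for r y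
  proof -
    obtain v where "v \<in> V" "y = x \<otimes> v" using ry unfolding scale_def by blast
    thus ?thesis using assms idealD[OF assms(1)] ry(1)
      by (auto simp: scale_def m_lcomm subset_iff intro!: image_eqI[of _ _ "r \<otimes> v"])
  qed
  show "scale x V \<subseteq> carrier R" using assms idealD(1)[OF assms(1)] by (auto simp: scale_def)
  show "\<zero> \<in> scale x V" using assms idealD(2)[OF assms(1)]
    by (auto simp: scale_def intro!: image_eqI[of _ _ \<zero>])
qed

text \<open>The universal property of the sum. Two ideals built from sums are shown equal below by
  checking that the same ideals \<open>K\<close> contain them, which avoids computing with
  elements.\<close>

lemma sum_subset_iff:
  assumes "ideal A R" "ideal B R" "ideal K R"
  shows "A <+> B \<subseteq> K \<longleftrightarrow> A \<subseteq> K \<and> B \<subseteq> K"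
proof
  assume *: "A <+> B \<subseteq> K"
  have "a \<in> K" if "a \<in> A" for a
  proof -
    have "a = a \<oplus> \<zero>" using that idealD(1)[OF assms(1)] by auto
    hence "a \<in> A <+> B" using that idealD(2)[OF assms(2)] by (auto simp: set_add_def')
    thus ?thesis using * by blast
  qed
  moreover have "b \<in> K" if "b \<in> B" for b
  proof -
    have "b = \<zero> \<oplus> b" using that idealD(1)[OF assms(2)] by auto
    hence "b \<in> A <+> B" using that idealD(2)[OF assms(1)] by (auto simp: set_add_def')
    thus ?thesis using * by blast
  qed
  ultimately show "A \<subseteq> K \<and> B \<subseteq> K" by blast
next
  assume "A \<subseteq> K \<and> B \<subseteq> K"
  thus "A <+> B \<subseteq> K" using idealD(3)[OF assms(3)] by (auto simp: set_add_def')
qed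

lemma sum_upper:
  assumes "ideal A R" "ideal B R"
  shows "A \<subseteq> A <+> B" "B \<subseteq> A <+> B"
  using sum_subset_iff[OF assms add_ideals[OF assms]] by auto

lemma cgenideal_subset_iff:
  assumes "ideal K R" "x \<in> carrier R"
  shows "PIdl x \<subseteq> K \<longleftrightarrow> x \<in> K"
  using assms cgenideal_minimal cgenideal_self by blast

lemma mem_sum_cgenideal:
  "y \<in> A <+> PIdl x \<longleftrightarrow> (\<exists>v\<in>A. \<exists>a\<in>carrier R. y = v \<oplus> a \<otimes> x)"
  by (auto simp: set_add_def' cgenideal_def)

text \<open>\<open>x V\<close> lies in \<open>K\<close> exactly when \<open>V\<close> lies in
  \<open>colon K x\<close>, so multiplication by \<open>x\<close> is compatible with the universal
  property of sums.\<close>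

lemma scale_sum_subset_iff:
  assumes "ideal A R" "ideal B R" "ideal K R" "x \<in> carrier R"
  shows "scale x (A <+> B) \<subseteq> K \<longleftrightarrow> scale x A \<subseteq> K \<and> scale x B \<subseteq> K"
proof -
  have *: "scale x V \<subseteq> K \<longleftrightarrow> V \<subseteq> colon K x" if "ideal V R" for V
    using idealD(1)[OF that] assms(4) m_comm[OF assms(4)]
    by (auto simp: scale_def colon_def subset_iff image_iff)
  show ?thesis
    using sum_subset_iff[OF assms(1,2) colon_ideal[OF assms(3,4)]] assms
    by (simp add: * add_ideals)
qed

lemma scale_cgenideal_subset_iff:
  assumes "ideal K R" "x \<in> carrier R" "y \<in> carrier R"
  shows "scale x (PIdl y) \<subseteq> K \<longleftrightarrow> x \<otimes> y \<in> K"
proof -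
  have "scale x (PIdl y) \<subseteq> K \<longleftrightarrow> PIdl y \<subseteq> colon K x"
    using idealD(1)[OF cgenideal_ideal[OF assms(3)]] assms(2) m_comm[OF assms(2)]
    by (auto simp: scale_def colon_def subset_iff image_iff)
  also have "\<dots> \<longleftrightarrow> x \<otimes> y \<in> K"
    using cgenideal_subset_iff[OF colon_ideal[OF assms(1,2)] assms(3)] assms
    by (auto simp: colon_def m_comm)
  finally show ?thesis .
qed

lemma scale_subset:
  assumes "ideal A R" "x \<in> carrier R" shows "scale x A \<subseteq> A"
  using assms idealD(5) by (auto simp: scale_def)

definition ideal_power :: "'a set \<Rightarrow> nat \<Rightarrow> 'a set" where
  "ideal_power I n = I [^]\<^bsub>ideals_set R\<^esub> n"

lemma ideal_power_0 [simp]: "ideal_power I 0 = carrier R"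
  by (simp add: ideal_power_def ideals_set_def nat_pow_def)

lemma ideal_power_Suc [simp]: "ideal_power I (Suc n) = ideal_power I n \<cdot> I"
  by (simp add: ideal_power_def ideals_set_def nat_pow_def)

lemma ideal_power_ideal:
  assumes "ideal I R" shows "ideal (ideal_power I n) R"
  by (induction n) (simp_all add: oneideal ideal_prod_is_ideal assms)

lemma pow_mem_ideal_power:
  assumes "ideal I R" "x \<in> I" shows "x [^] n \<in> ideal_power I n"
  by (induction n) (use assms in \<open>auto intro: ideal_prod.prod\<close>)

lemma ideal_prod_subset:
  assumes "ideal K R" "\<And>x y. x \<in> I \<Longrightarrow> y \<in> J \<Longrightarrow> x \<otimes> y \<in> K"
  shows "I \<cdot> J \<subseteq> K"
proof
  fix z assume "z \<in> I \<cdot> J"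
  thus "z \<in> K" by induction (use assms idealD(3) in auto)
qed

end

section \<open>Maximal members of families of ideals, and associated primes\<close>

context noetherian_ring begin

text \<open>A nonempty chain of ideals in a Noetherian ring contains its union, so Zorn's lemma
  applies.\<close>

lemma maximal_ideal_exists:
  assumes "\<A> \<noteq> {}" "\<And>I. I \<in> \<A> \<Longrightarrow> ideal I R"
  shows "\<exists>M\<in>\<A>. \<forall>I\<in>\<A>. M \<subseteq> I \<longrightarrow> I = M"
proof (rule subset_Zorn_nonempty[OF assms(1)])
  fix C assume "C \<noteq> {}" and C: "subset.chain \<A> C"
  hence "subset.chain {I. ideal I R} C" using assms(2) by (auto simp: subset.chain_def)
  hence "\<Union>C \<in> C" using ideal_chain_is_trivial \<open>C \<noteq> {}\<close> by blast
  thus "\<Union>C \<in> \<A>" using C by (auto simp: subset.chain_def)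
qed

end

text \<open>A colon ideal that is maximal among the \<open>colon U b\<close> with \<open>b\<close>
  outside \<open>U\<close> is prime: if it contains \<open>x \<otimes> y\<close> but not
  \<open>y\<close>, then \<open>colon U (y \<otimes> b)\<close> contains it, hence equals it, and
  has \<open>x\<close> as an element.\<close>

lemma (in cring) associated_prime_exists:
  assumes "noetherian_ring R" "ideal U R" "U \<noteq> carrier R"
  shows "\<exists>b\<in>carrier R - U. primeideal (colon U b) R"
proof -
  interpret noetherian_ring R by fact
  have Uc: "U \<subseteq> carrier R" using idealD(1)[OF assms(2)] .
  let ?A = "colon U ` (carrier R - U)"
  have "\<exists>M\<in>?A. \<forall>I\<in>?A. M \<subseteq> I \<longrightarrow> I = M"
    using Uc assms by (intro maximal_ideal_exists) (auto intro: colon_ideal)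
  then obtain b where b: "b \<in> carrier R - U"
    and mx: "\<And>b'. b' \<in> carrier R - U \<Longrightarrow> colon U b \<subseteq> colon U b' \<Longrightarrow> colon U b' = colon U b"
    by blast
  have "primeideal (colon U b) R"
  proof (rule primeidealI)
    show "ideal (colon U b) R" using b assms colon_ideal by blast
    show "cring R" by (rule cring_axioms)
    have "\<one> \<notin> colon U b" using b by (simp add: colon_def)
    thus "carrier R \<noteq> colon U b" by auto
    fix x y assume xy: "x \<in> carrier R" "y \<in> carrier R" "x \<otimes> y \<in> colon U b"
    show "x \<in> colon U b \<or> y \<in> colon U b"
    proof (rule disjCI)
      assume "y \<notin> colon U b"
      hence yb: "y \<otimes> b \<in> carrier R - U" using xy b by (auto simp: colon_def)
      have "colon U b \<subseteq> colon U (y \<otimes> b)"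
        using xy b idealD(5)[OF assms(2), of y] m_lcomm[of _ y b] by (auto simp: colon_def)
      from mx[OF yb this] have "colon U (y \<otimes> b) = colon U b" .
      moreover have "x \<in> colon U (y \<otimes> b)" using xy b by (auto simp: colon_def m_assoc)
      ultimately show "x \<in> colon U b" by simp
    qed
  qed
  thus ?thesis using b by blast
qed

section \<open>Upper bounds for the length of a quotient of a local ring\<close>

locale noetherian_local_ring = cring R for R (structure) +
  fixes m
  assumes noetherian: "noetherian_ring R" and local_ring: "local_ring R m"
begin

lemma m_maximal: "maximalideal m R"
  using local_ring by (simp add: local_ring_def)

lemma m_ideal: "ideal m R"
  using m_maximal by (rule maximalideal.axioms)

lemma m_prime: "primeideal m R"
  using m_maximal by (rule maximalideal_prime)

lemma m_subset: "m \<subseteq> carrier R" 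
  using idealD(1)[OF m_ideal] .

lemma one_notin_m: "\<one> \<notin> m"
  using ideal.one_imp_carrier[OF m_ideal] maximalideal.I_notcarr[OF m_maximal] by auto

lemma proper_ideal_subset_m:
  assumes "ideal I R" "I \<noteq> carrier R" shows "I \<subseteq> m"
proof -
  interpret noetherian_ring R by (rule noetherian)
  let ?A = "{J. ideal J R \<and> I \<subseteq> J \<and> J \<noteq> carrier R}"
  have "\<exists>M\<in>?A. \<forall>J\<in>?A. M \<subseteq> J \<longrightarrow> J = M"
    using assms by (intro maximal_ideal_exists) auto
  then obtain M where M: "ideal M R" "I \<subseteq> M" "M \<noteq> carrier R"
    and mx: "\<And>J. ideal J R \<Longrightarrow> J \<noteq> carrier R \<Longrightarrow> M \<subseteq> J \<Longrightarrow> J = M" by fastforce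
  have "maximalideal M R" using M mx by (intro maximalidealI) auto
  hence "M = m" using local_ring by (simp add: local_ring_def)
  thus ?thesis using M by simp
qed

lemma unit_if_notin_m:
  assumes "u \<in> carrier R" "u \<notin> m" shows "\<exists>v\<in>carrier R. v \<otimes> u = \<one>"
proof -
  have "PIdl u = carrier R"
    using proper_ideal_subset_m[OF cgenideal_ideal[OF assms(1)]] cgenideal_self assms by blast
  hence "\<one> \<in> PIdl u" by simp
  thus ?thesis by (auto simp: cgenideal_def)
qed

lemma prime_subset_m: "primeideal I R \<Longrightarrow> I \<subseteq> m"
  using proper_ideal_subset_m primeideal.axioms(1) primeideal.I_notcarr by blast

text \<open>\<open>length_le U n\<close> bounds the length of \<open>R/U\<close> by
  \<open>n\<close>: the ring is reached from \<open>U\<close> in \<open>n\<close> steps, each adding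
  a generator that \<open>m\<close> multiplies into the ideal reached so far. The generator may
  already lie there, so \<open>n\<close> is only an upper bound.\<close>

inductive length_le :: "'a set \<Rightarrow> nat \<Rightarrow> bool" where
  length_le_carrier: "length_le (carrier R) 0"
| length_le_step: "length_le (U <+> PIdl u) n \<Longrightarrow> ideal U R \<Longrightarrow> u \<in> carrier R \<Longrightarrow>
     (\<And>a. a \<in> m \<Longrightarrow> a \<otimes> u \<in> U) \<Longrightarrow> length_le U (Suc n)"

lemma length_le_ideal: "length_le U n \<Longrightarrow> ideal U R"
  by (induction rule: length_le.induct) (auto intro: oneideal)

lemma sum_cgenideal_absorb:
  assumes "ideal U R" "u \<in> U" shows "U <+> PIdl u = U"
proof -
  have u: "u \<in> carrier R" using assms idealD(1) by blast
  note PI = cgenideal_ideal[OF u]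
  show ?thesis
    using sum_subset_iff[OF assms(1) PI assms(1)] sum_upper[OF assms(1) PI] 
      cgenideal_subset_iff[OF assms(1) u] assms(2) by blast
qed

lemma length_le_mono:
  assumes "length_le U n" "n \<le> n'" shows "length_le U n'"
  using assms(2,1)
proof (induction n' rule: dec_induct)
  case (step n')
  have l: "length_le U n'" and U: "ideal U R" using step length_le_ideal by blast+
  show ?case
    by (rule length_le_step[of U \<zero>])
      (use l U idealD(2)[OF U] m_subset in \<open>auto simp: sum_cgenideal_absorb subset_iff\<close>)
qed

text \<open>The form in which length bounds are used later: a bounded, strictly increasing rank
  limits the chains of ideals above \<open>U\<close>. The induction takes as rank of
  \<open>K\<close> the rank of \<open>K + (u)\<close>, plus 1 if \<open>u\<close> is in
  \<open>K\<close>.\<close>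

lemma length_le_rank:
  assumes "length_le U n"
  shows "\<exists>\<rho>. (\<forall>K. ideal K R \<and> U \<subseteq> K \<longrightarrow> \<rho> K \<le> n) \<and>
    (\<forall>K K'. ideal K R \<and> ideal K' R \<and> U \<subseteq> K \<and> K \<subset> K' \<longrightarrow> \<rho> K < (\<rho> K' :: nat))"
  using assms
proof induction
  case length_le_carrier
  show ?case using idealD(1) by (intro exI[of _ "\<lambda>_. 0"]) blast
next
  case (length_le_step U u n)
  then obtain \<rho> where le: "\<And>K. ideal K R \<Longrightarrow> U <+> PIdl u \<subseteq> K \<Longrightarrow> \<rho> K \<le> n"
    and less: "\<And>K K'. ideal K R \<Longrightarrow> ideal K' R \<Longrightarrow> U <+> PIdl u \<subseteq> K \<Longrightarrow> K \<subset> K' \<Longrightarrow> \<rho> K < (\<rho> K' :: nat)"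
    by metis
  note u = \<open>u \<in> carrier R\<close> and U = \<open>ideal U R\<close>
  note PI = cgenideal_ideal[OF u]
  define E where "E K = K <+>\<^bsub>R\<^esub> PIdl u" for K
  have E_ideal: "ideal (E K) R" if "ideal K R" for K unfolding E_def using that PI add_ideals by blast
  have E_sub: "U <+> PIdl u \<subseteq> E K" if "ideal K R" "U \<subseteq> K" for K
    using that sum_upper[OF that(1) PI] sum_subset_iff[OF U PI E_ideal[OF that(1)]] by (auto simp: E_def)
  have E_mono: "E K \<subseteq> E K'" if "ideal K R" "ideal K' R" "K \<subseteq> K'" for K K'
    using that sum_upper[OF that(2) PI] sum_subset_iff[OF that(1) PI E_ideal[OF that(2)]] by (auto simp: E_def)
  \<comment> \<open>Suppose \<open>E K'\<close> is inside \<open>E K\<close> and \<open>u\<close> is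
    not in \<open>K'\<close>. An \<open>x\<close> in \<open>K'\<close> is then
    \<open>v + a u\<close> with \<open>v\<close> in \<open>K\<close>; a unit \<open>a\<close> would
    put \<open>u\<close> into \<open>K'\<close>, so \<open>a\<close> is in \<open>m\<close> and
    \<open>a u\<close> is in \<open>U\<close>.\<close>
  have E_less: "E K \<subset> E K'" if K: "ideal K R" "ideal K' R" "K \<subset> K'" "U \<subseteq> K" "u \<in> K \<longleftrightarrow> u \<in> K'" for K K'
  proof (cases "u \<in> K")
    case True
    thus ?thesis using that sum_cgenideal_absorb by (simp add: E_def)
  next
    case False
    have "K' \<subseteq> K" if "E K' \<subseteq> E K"
    proof
      fix x assume x: "x \<in> K'"
      hence "x \<in> E K" using that sum_upper(1)[OF K(2) PI] by (auto simp: E_def)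
      then obtain v a where va: "v \<in> K" "a \<in> carrier R" "x = v \<oplus> a \<otimes> u"
        by (auto simp: E_def mem_sum_cgenideal)
      have vc: "v \<in> carrier R" using va idealD(1)[OF K(1)] by blast
      have "a \<otimes> u = x \<ominus> v" using va vc u by (simp add: a_minus_def) algebra
      moreover have "v \<in> K'" using va K by blast
      ultimately have au: "a \<otimes> u \<in> K'" using x idealD(4)[OF K(2)] by metis
      have "a \<in> m"
      proof (rule ccontr)
        assume "a \<notin> m"
        then obtain w where w: "w \<in> carrier R" "w \<otimes> a = \<one>" using unit_if_notin_m va by blast
        have "u = w \<otimes> (a \<otimes> u)" using w va u by (simp flip: m_assoc)
        hence "u \<in> K'" using idealD(5)[OF K(2) w(1) au] by simp
        thus False using False K by blast
      qed
      hence "a \<otimes> u \<in> K" using length_le_step K by blast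
      thus "x \<in> K" using va idealD(3)[OF K(1)] by blast
    qed
    thus ?thesis using E_mono K by blast
  qed
  define \<rho>' where "\<rho>' K = \<rho> (E K) + (if u \<in> K then 1 else 0)" for K
  show ?case
  proof (intro exI conjI allI impI)
    fix K assume "ideal K R \<and> U \<subseteq> K"
    thus "\<rho>' K \<le> Suc n" using le[OF E_ideal E_sub] by (fastforce simp: \<rho>'_def)
  next
    fix K K' assume K: "ideal K R \<and> ideal K' R \<and> U \<subseteq> K \<and> K \<subset> K'"
    have "\<rho> (E K) \<le> \<rho> (E K')"
    proof (cases "E K = E K'")
      case False
      hence "E K \<subset> E K'" using E_mono K by blast
      thus ?thesis using less[of "E K" "E K'"] E_ideal E_sub K by simp
    qed simp
    moreover have "\<rho> (E K) < \<rho> (E K')" if "u \<in> K \<longleftrightarrow> u \<in> K'"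
      using less[of "E K" "E K'"] E_ideal E_sub K E_less that by auto
    ultimately show "\<rho>' K < \<rho>' K'" using K by (auto simp: \<rho>'_def)
  qed
qed

text \<open>Multiplication by \<open>x\<close> maps \<open>R/V\<close> onto
  \<open>(I + (x))/(I + x V)\<close>. So the steps from \<open>V\<close> up to the ring, multiplied
  by \<open>x\<close>, lead from \<open>I + x V\<close> up to \<open>I + (x)\<close>, and
  \<open>k\<close> more steps reach the ring.\<close>

lemma length_le_add:
  assumes "length_le V n" "ideal I R" "x \<in> carrier R" "length_le (I <+> PIdl x) k"
  shows "length_le (I <+> scale x V) (n + k)"
  using assms(1)
proof induction
  case length_le_carrier
  have "scale x (carrier R) = PIdl x"
    using m_comm[OF assms(3)] by (auto simp: scale_def cgenideal_def)
  thus ?case using assms(4) by simp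
next
  case (length_le_step V v n)
  note x = assms(3) and I = assms(2)
  note V = \<open>ideal V R\<close> and v = \<open>v \<in> carrier R\<close>
  note PI = cgenideal_ideal[OF v]
  have xv: "x \<otimes> v \<in> carrier R" using x v by simp
  note ids = scale_ideal[OF V x] scale_ideal[OF add_ideals[OF V PI] x] scale_ideal[OF PI x] cgenideal_ideal[OF xv]
  note ids2 = add_ideals[OF I ids(1)] add_ideals[OF I ids(2)]
  note ids3 = add_ideals[OF ids2(1) ids(4)]
  have 1: "I <+> scale x V <+> PIdl (x \<otimes> v) \<subseteq> K \<longleftrightarrow> I <+> scale x (V <+> PIdl v) \<subseteq> K" if "ideal K R" for K
    using that ids ids2 ids3 I x xv V v PI
    by (simp add: sum_subset_iff cgenideal_subset_iff scale_sum_subset_iff scale_cgenideal_subset_iff)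
  have eq: "I <+> scale x V <+> PIdl (x \<otimes> v) = I <+> scale x (V <+> PIdl v)"
    using 1[OF ids3] 1[OF ids2(2)] by blast
  show ?case
    unfolding add_Suc
  proof (rule length_le.length_le_step[OF _ ids2(1) xv])
    show "length_le (I <+> scale x V <+> PIdl (x \<otimes> v)) (n + k)" unfolding eq by fact
    fix a assume a: "a \<in> m"
    hence ac: "a \<in> carrier R" using m_subset by blast
    have "a \<otimes> (x \<otimes> v) = x \<otimes> (a \<otimes> v)" using ac x v by (simp add: m_lcomm)
    also have "\<dots> \<in> scale x V" using length_le_step.hyps a by (auto simp: scale_def)
    finally show "a \<otimes> (x \<otimes> v) \<in> I <+> scale x V" using sum_upper(2)[OF I ids(1)] by blast
  qed
qed

end

section \<open>Polynomial growth of lengths\<close>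

context noetherian_local_ring begin

text \<open>\<open>dim(R/I) \<le> d\<close>, expressed through chains of primes of \<open>R\<close>
  above \<open>I\<close>; a chain of length \<open>n\<close> has \<open>n + 1\<close>
  primes.\<close>

definition coheight_le :: "'a set \<Rightarrow> nat \<Rightarrow> bool" where
  "coheight_le I d \<longleftrightarrow> (\<forall>n Q. (\<forall>i\<le>n. primeideal (Q i) R \<and> I \<subseteq> Q i) \<and> (\<forall>i<n. Q i \<subset> Q (Suc i)) \<longrightarrow> n \<le> d)"

lemma coheight_le_mono:
  assumes "coheight_le I d" "I \<subseteq> J" shows "coheight_le J d"
  using assms unfolding coheight_le_def by (meson subset_trans)

lemma coheight_le_prime_less:
  assumes "coheight_le I d" "primeideal I R" "I \<subset> J" "d = Suc d'"
  shows "coheight_le J d'"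
  unfolding coheight_le_def
proof (intro allI impI)
  fix n Q assume Q: "(\<forall>i\<le>n. primeideal (Q i) R \<and> J \<subseteq> Q i) \<and> (\<forall>i<n. Q i \<subset> Q (Suc i))"
  define Q' where "Q' i = (case i of 0 \<Rightarrow> I | Suc i \<Rightarrow> Q i)" for i
  have "\<forall>i\<le>Suc n. primeideal (Q' i) R \<and> I \<subseteq> Q' i"
    using Q assms by (auto simp: Q'_def split: nat.split)
  moreover have "\<forall>i<Suc n. Q' i \<subset> Q' (Suc i)"
    using Q assms by (auto simp: Q'_def split: nat.split) 
  ultimately have "Suc n \<le> d" using assms(1) unfolding coheight_le_def by blast
  thus "n \<le> d'" using assms by simp
qed

lemma ideal_power_subset:
  assumes "ideal I R" "n > 0" shows "ideal_power I n \<subseteq> I"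
proof -
  obtain k where "n = Suc k" using assms(2) by (cases n) auto
  thus ?thesis
    using ideal_prod_inter[OF ideal_power_ideal[OF assms(1)] assms(1)] by auto
qed

text \<open>Induction with \<open>length_le_add\<close> for \<open>V = I + (x^j)\<close>: since
  \<open>x I\<close> lies in \<open>I\<close>, the ideal \<open>I + x V\<close> is
  \<open>I + (x^(j+1))\<close>.\<close>

lemma length_le_pow:
  assumes "ideal I R" "x \<in> carrier R" "length_le (I <+> PIdl x) k"
  shows "length_le (I <+> PIdl (x [^] (j::nat))) (j * k)"
proof (induction j)
  case 0
  have "PIdl \<one> = carrier R" by (force simp: cgenideal_def)
  moreover have "I <+> carrier R = carrier R"
    using sum_upper[OF assms(1) oneideal] idealD(1)[OF add_ideals[OF assms(1) oneideal]] by blast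
  ultimately show ?case using length_le_carrier by simp
next
  case (Suc j)
  let ?y = "x [^] j"
  have y: "?y \<in> carrier R" and xy: "x \<otimes> ?y \<in> carrier R" using assms by auto
  note ids = assms(1) cgenideal_ideal[OF y] cgenideal_ideal[OF xy]
  note V = add_ideals[OF ids(1,2)]
  have "length_le (I <+> scale x (I <+> PIdl ?y)) (j * k + k)"
    using length_le_add[OF Suc assms] .
  moreover have "I <+> scale x (I <+> PIdl ?y) = I <+> PIdl (x \<otimes> ?y)"
  proof -
    note ids2 = ids V scale_ideal[OF V assms(2)] scale_ideal[OF assms(1,2)] scale_ideal[OF ids(2) assms(2)]
    note ids3 = add_ideals[OF assms(1) ids2(5)] add_ideals[OF assms(1) ids(3)]
    have "I <+> scale x (I <+> PIdl ?y) \<subseteq> K \<longleftrightarrow> I <+> PIdl (x \<otimes> ?y) \<subseteq> K" if "ideal K R" for K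
      using that ids2 ids3 assms y xy scale_subset[OF assms(1,2)]
      by (auto simp: sum_subset_iff cgenideal_subset_iff scale_sum_subset_iff scale_cgenideal_subset_iff)
    thus ?thesis using ids3 by blast
  qed
  moreover have "x [^] Suc j = x \<otimes> ?y" using assms(2) y m_comm by simp
  ultimately show ?case by (simp add: add.commute)
qed

lemma sum_cgenideal_commute:
  assumes "ideal A R" "ideal B R" "x \<in> carrier R"
  shows "A <+> B <+> PIdl x = A <+> PIdl x <+> B"
proof -
  note P = cgenideal_ideal[OF assms(3)]
  note ids = add_ideals[OF assms(1,2)] add_ideals[OF assms(1) P]
  note ids2 = add_ideals[OF ids(1) P] add_ideals[OF ids(2) assms(2)]
  have "A <+> B <+> PIdl x \<subseteq> K \<longleftrightarrow> A <+> PIdl x <+> B \<subseteq> K" if "ideal K R" for K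
    using that ids ids2 assms P by (auto simp: sum_subset_iff)
  thus ?thesis using ids2 by blast
qed

text \<open>Noetherian induction on \<open>I\<close>: if \<open>a b \<in> I\<close>, the length is at most the sum of those for
  \<open>I + (a)\<close> and \<open>I + (b)\<close>; if \<open>I\<close> is prime, an element \<open>x \<in> m - I\<close> lowers the dimension, and passing
  from \<open>x\<close> to \<open>x\<^sup>M\<close> costs a factor \<open>M\<close>.\<close>

lemma length_growth:
  assumes "ideal I R" "coheight_le I d"
  shows "\<exists>C. \<forall>M. length_le (I <+> ideal_power m M) (C * M ^ d)"
proof (rule ccontr)
  assume *: "\<not> ?thesis"
  interpret N: noetherian_ring R by (rule noetherian)
  define growth where "growth I d \<longleftrightarrow> (\<exists>C. \<forall>M. length_le (I <+>\<^bsub>R\<^esub> ideal_power m M) (C * M ^ d))" for I d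
  \<comment> \<open>The exponent \<open>d\<close> is quantified inside the family, because the prime
    case needs the larger ideal \<open>I + (x)\<close> with the smaller exponent
    \<open>d'\<close>.\<close>
  let ?A = "{I. ideal I R \<and> (\<exists>d. coheight_le I d \<and> \<not> growth I d)}"
  have "\<exists>I\<in>?A. \<forall>J\<in>?A. I \<subseteq> J \<longrightarrow> J = I"
    by (rule N.maximal_ideal_exists) (use assms * in \<open>auto simp: growth_def\<close>)
  then obtain I d where I: "ideal I R" "coheight_le I d" "\<not> growth I d"
    and mx: "\<And>J d. ideal J R \<Longrightarrow> coheight_le J d \<Longrightarrow> I \<subset> J \<Longrightarrow> growth J d" by blast
  note mP = ideal_power_ideal[OF m_ideal]
  note IM = add_ideals[OF I(1) mP]
  have M0: "I <+> ideal_power m 0 = carrier R"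
    using sum_upper[OF I(1) mP, of 0] idealD(1)[OF IM, of 0] by auto
  consider "I = carrier R" | "primeideal I R" "I = m" | "primeideal I R" "I \<noteq> m"
    | "\<not> primeideal I R" "I \<noteq> carrier R" by blast
  thus False
  proof cases
    case 1
    have "I <+> ideal_power m M = carrier R" for M
      using sum_upper[OF I(1) mP, of M] idealD(1)[OF IM, of M] 1 by auto
    hence "growth I d" using length_le_carrier unfolding growth_def by (intro exI[of _ 0]) simp
    thus False using I by simp
  next
    case 2
    \<comment> \<open>For \<open>M = 0\<close> the sum is the whole ring; for \<open>M > 0\<close>
      it is \<open>m\<close>, one step below the ring, and \<open>1 \<le> M^d\<close>.\<close>
    have "length_le (I <+> ideal_power m M) (1 * M ^ d)" for M
    proof (cases "M = 0")
      case True
      thus ?thesis using M0 length_le_mono[OF length_le_carrier] by simp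
    next
      case False
      hence "I <+> ideal_power m M = m"
        using sum_subset_iff[OF I(1) mP, of m M] sum_upper[OF I(1) mP, of M] 2 m_ideal
          ideal_power_subset[OF m_ideal, of M] by auto
      moreover have "length_le m (Suc 0)"
      proof (rule length_le_step)
        have "m <+> PIdl \<one> = carrier R"
        proof (rule ccontr)
          assume "m <+> PIdl \<one> \<noteq> carrier R"
          hence "m <+> PIdl \<one> \<subseteq> m"
            by (intro proper_ideal_subset_m add_ideals m_ideal cgenideal_ideal) auto
          thus False
            using sum_upper(2)[OF m_ideal cgenideal_ideal[of \<one>]] cgenideal_self[of \<one>] one_notin_m by auto
        qed
        thus "length_le (m <+> PIdl \<one>) 0" using length_le_carrier by simp
      qed (use m_ideal m_subset in auto)
      ultimately show ?thesis using False length_le_mono[of m "Suc 0" "1 * M ^ d"] by simp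
    qed
    hence "growth I d" unfolding growth_def by blast
    thus False using I by simp
  next
    case 3
    have "I \<subset> m" using 3 prime_subset_m by blast
    then obtain x where x: "x \<in> m" "x \<notin> I" by blast
    have xc: "x \<in> carrier R" using x m_subset by blast
    note PI = cgenideal_ideal[OF xc]
    have "d \<noteq> 0"
    proof
      assume "d = 0"
      define Q where "Q i = (if i = 0 then I else m)" for i :: nat
      have "(\<forall>i\<le>1. primeideal (Q i) R \<and> I \<subseteq> Q i) \<and> (\<forall>i<1. Q i \<subset> Q (Suc i))"
        using \<open>I \<subset> m\<close> 3 m_prime by (auto simp: Q_def)
      hence "1 \<le> d" using I(2) unfolding coheight_le_def by blast
      thus False using \<open>d = 0\<close> by simp
    qed
    then obtain d' where d': "d = Suc d'" by (cases d) auto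
    have less: "I \<subset> I <+> PIdl x"
      using sum_upper[OF I(1) PI] cgenideal_self[OF xc] x by auto
    have "growth (I <+> PIdl x) d'"
      using mx[OF add_ideals[OF I(1) PI] _ less] coheight_le_prime_less[OF I(2) 3(1) less d'] by blast
    then obtain C where C: "\<And>M. length_le (I <+> PIdl x <+> ideal_power m M) (C * M ^ d')"
      unfolding growth_def by blast
    have "length_le (I <+> ideal_power m M) (C * M ^ d)" for M
    proof -
      have "length_le (I <+> ideal_power m M <+> PIdl x) (C * M ^ d')"
        using C sum_cgenideal_commute[OF I(1) mP xc] by simp
      from length_le_pow[OF IM xc this, of M]
      have "length_le (I <+> ideal_power m M <+> PIdl (x [^] M)) (M * (C * M ^ d'))" .
      moreover have "x [^] M \<in> I <+> ideal_power m M"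
        using sum_upper(2)[OF I(1) mP] pow_mem_ideal_power[OF m_ideal x(1)] by blast
      ultimately show ?thesis
        using sum_cgenideal_absorb[OF IM] d' by (simp add: mult.left_commute)
    qed
    hence "growth I d" unfolding growth_def by blast
    thus False using I by simp
  next
    case 4
    then obtain a b where ab: "a \<in> carrier R" "b \<in> carrier R" "a \<otimes> b \<in> I" "a \<notin> I" "b \<notin> I"
      using primeidealI[OF I(1) cring_axioms] by blast
    have gr: "growth (I <+> PIdl z) d" if z: "z \<in> carrier R" "z \<notin> I" for z
    proof (rule mx)
      note PI = cgenideal_ideal[OF z(1)]
      show "ideal (I <+> PIdl z) R" using I(1) PI by (rule add_ideals)
      show "I \<subset> I <+> PIdl z"
        using sum_upper[OF I(1) PI] cgenideal_self[OF z(1)] z by auto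
      thus "coheight_le (I <+> PIdl z) d" using coheight_le_mono[OF I(2)] by blast
    qed
    obtain C1 where C1: "\<And>M. length_le (I <+> PIdl a <+> ideal_power m M) (C1 * M ^ d)"
      using gr[of a] ab unfolding growth_def by blast
    obtain C2 where C2: "\<And>M. length_le (I <+> PIdl b <+> ideal_power m M) (C2 * M ^ d)"
      using gr[of b] ab unfolding growth_def by blast
    note Pb = cgenideal_ideal[OF ab(2)]
    note Ib = add_ideals[OF I(1) Pb]
    have "length_le (I <+> ideal_power m M) ((C2 + C1) * M ^ d)" for M
    proof -
      let ?V = "I <+> PIdl b <+> ideal_power m M"
      note V = add_ideals[OF Ib mP[of M]]
      have "length_le (I <+> ideal_power m M <+> PIdl a) (C1 * M ^ d)"
        using C1 sum_cgenideal_commute[OF I(1) mP ab(1)] by simp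
      \<comment> \<open>Additivity modulo \<open>I + m^M\<close> with the element \<open>a\<close>.
        As \<open>a b\<close> is in \<open>I\<close>, the multiple \<open>a V\<close> lies in
        \<open>I + m^M\<close> and drops out of the sum.\<close>
      from length_le_add[OF C2 IM ab(1) this]
      have 1: "length_le (I <+> ideal_power m M <+> scale a ?V) (C2 * M ^ d + C1 * M ^ d)" .
      note IMM = IM[of M]
      have "scale a I \<subseteq> I <+> ideal_power m M" "scale a (ideal_power m M) \<subseteq> I <+> ideal_power m M"
        using scale_subset[OF I(1) ab(1)] scale_subset[OF mP ab(1)] sum_upper[OF I(1) mP] by blast+
      moreover have "a \<otimes> b \<in> I <+> ideal_power m M" using ab(3) sum_upper[OF I(1) mP] by blast
      ultimately have "scale a ?V \<subseteq> I <+> ideal_power m M"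
        using scale_sum_subset_iff[OF Ib mP IMM ab(1)] scale_sum_subset_iff[OF I(1) Pb IMM ab(1)]
          scale_cgenideal_subset_iff[OF IMM ab(1,2)] by simp
      hence "I <+> ideal_power m M <+> scale a ?V = I <+> ideal_power m M"
        using sum_subset_iff[OF IMM scale_ideal[OF V ab(1)] IMM] sum_upper[OF IMM scale_ideal[OF V ab(1)]]
        by blast
      thus ?thesis using 1 by (simp add: add_mult_distrib)
    qed
    hence "growth I d" unfolding growth_def by blast
    thus False using I by simp
  qed
qed

end

section \<open>Standard monomials\<close>

lemma sum_digits_less:
  fixes b :: "nat \<Rightarrow> nat"
  assumes "\<And>i. i < r \<Longrightarrow> b i < B"
  shows "(\<Sum>i<r. b i * B ^ i) < B ^ r"
  using assms
proof (induction r)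
  case (Suc r)
  have "(\<Sum>i<r. b i * B ^ i) < B ^ r" using Suc by simp
  moreover have "Suc (b r) * B ^ r \<le> B * B ^ r" using Suc.prems[of r] by (intro mult_right_mono) auto
  ultimately show ?case by simp
qed simp

text \<open>Uniqueness of base \<open>B\<close> expansions, from the top digit downwards; it will
  let the weight alone determine the exponents of a monomial with small exponents.\<close>

lemma sum_digits_inj:
  fixes b c :: "nat \<Rightarrow> nat"
  assumes "\<And>i. i < r \<Longrightarrow> b i < B" "\<And>i. i < r \<Longrightarrow> c i < B"
    and "(\<Sum>i<r. b i * B ^ i) = (\<Sum>i<r. c i * B ^ i)" and "i < r"
  shows "b i = c i"
  using assms
proof (induction r)
  case (Suc r)
  have lt: "(\<Sum>i<r. b i * B ^ i) < B ^ r" "(\<Sum>i<r. c i * B ^ i) < B ^ r"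
    using Suc by (auto intro!: sum_digits_less)
  have "((\<Sum>i<r. b i * B ^ i) + b r * B ^ r) div B ^ r = ((\<Sum>i<r. c i * B ^ i) + c r * B ^ r) div B ^ r"
    using Suc.prems(3) by simp
  moreover have "B ^ r \<noteq> 0" using lt by linarith
  ultimately have r: "b r = c r" using lt by (simp add: div_mult_self1)
  hence "(\<Sum>i<r. b i * B ^ i) = (\<Sum>i<r. c i * B ^ i)" using Suc.prems(3) by simp
  thus ?case using Suc r by (cases "i = r") auto
qed simp

definition weight :: "(nat \<Rightarrow> nat) \<Rightarrow> nat \<Rightarrow> (nat \<Rightarrow> nat) \<Rightarrow> nat" where
  "weight v r b = (\<Sum>i<r. b i * v i)"

lemma weight_add: "weight v r (\<lambda>i. b i + c i) = weight v r b + weight v r c"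
  by (simp add: weight_def sum.distrib add_mult_distrib)

section \<open>Monomials in the generators and their weight filtration\<close>

context cring begin

definition mon :: "(nat \<Rightarrow> 'a) \<Rightarrow> nat \<Rightarrow> (nat \<Rightarrow> nat) \<Rightarrow> 'a" where
  "mon y r b = (\<Otimes>i\<in>{..<r}. y i [^] b i)"

context
  fixes y :: "nat \<Rightarrow> 'a" and r :: nat
  assumes y: "\<And>i. i < r \<Longrightarrow> y i \<in> carrier R"
begin

lemma mon_closed [simp]: "mon y r b \<in> carrier R"
  unfolding mon_def using y by (intro finprod_closed) auto

lemma mon_add: "mon y r (\<lambda>i. b i + c i) = mon y r b \<otimes> mon y r c"
proof -
  have "mon y r (\<lambda>i. b i + c i) = (\<Otimes>i\<in>{..<r}. y i [^] b i \<otimes> y i [^] c i)"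
    unfolding mon_def using y by (intro finprod_cong') (auto simp: nat_pow_mult)
  also have "\<dots> = mon y r b \<otimes> mon y r c"
    unfolding mon_def using y by (intro finprod_multf) auto
  finally show ?thesis .
qed

lemma mon_single:
  assumes "i < r" shows "mon y r (\<lambda>j. if i = j then n else 0) = y i [^] n"
proof -
  have "mon y r (\<lambda>j. if i = j then n else 0) = (\<Otimes>j\<in>{..<r}. if i = j then y j [^] n else \<one>)"
    unfolding mon_def using y by (intro finprod_cong') auto
  also have "\<dots> = y i [^] n" using assms y by (intro finprod_singleton) auto
  finally show ?thesis .
qed

lemma weight_single:
  assumes "i < r" shows "weight v r (\<lambda>j. if i = j then n else 0) = n * v i"
proof -
  have "weight v r (\<lambda>j. if i = j then n else 0) = (\<Sum>j<r. if i = j then n * v j else 0)"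
    unfolding weight_def by (intro sum.cong) auto
  thus ?thesis using assms by simp
qed

lemma mon_mem:
  assumes "ideal Q R" "i < r" "y i [^] (q::nat) \<in> Q" "q \<le> b i"
  shows "mon y r b \<in> Q"
proof -
  have "b = (\<lambda>j. (if i = j then q else 0) + (if i = j then b j - q else b j))"
    using assms(4) by (intro ext) auto
  hence "mon y r b = y i [^] q \<otimes> mon y r (\<lambda>j. if i = j then b j - q else b j)"
    using mon_add mon_single[OF assms(2)] by metis
  thus ?thesis using idealD(6)[OF assms(1)] assms(3) by simp
qed

text \<open>As they contain \<open>P\<close>, these ideals correspond to the weight filtration of
  \<open>R/P\<close>; monomials are thus always compared modulo \<open>P\<close>.\<close>

definition filt :: "'a set \<Rightarrow> (nat \<Rightarrow> nat) \<Rightarrow> nat \<Rightarrow> 'a set" where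
  "filt P v n = Idl (P \<union> {mon y r b | b. n \<le> weight v r b})"

context
  fixes P and v :: "nat \<Rightarrow> nat" assumes P: "P \<subseteq> carrier R"
begin

lemma gens_subset: "P \<union> {mon y r b | b. n \<le> weight v r b} \<subseteq> carrier R"
  using P by auto

lemma filt_ideal: "ideal (filt P v n) R"
  unfolding filt_def using gens_subset by (rule genideal_ideal)

lemma P_subset_filt: "P \<subseteq> filt P v n"
  and mon_mem_filt: "n \<le> weight v r b \<Longrightarrow> mon y r b \<in> filt P v n"
  using genideal_self[OF gens_subset, of n] unfolding filt_def by blast+

lemma filt_subset:
  assumes "ideal Q R" "P \<subseteq> Q" "\<And>b. n \<le> weight v r b \<Longrightarrow> mon y r b \<in> Q"
  shows "filt P v n \<subseteq> Q"
  unfolding filt_def using assms by (intro genideal_minimal) auto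

lemma filt_antimono: "n \<le> n' \<Longrightarrow> filt P v n' \<subseteq> filt P v n"
  by (rule filt_subset[OF filt_ideal P_subset_filt]) (auto intro: mon_mem_filt)

lemma filt_mult:
  assumes "x \<in> filt P v n" shows "x \<otimes> mon y r c \<in> filt P v (n + weight v r c)"
proof -
  have "filt P v n \<subseteq> colon (filt P v (n + weight v r c)) (mon y r c)"
  proof (rule filt_subset)
    show "ideal (colon (filt P v (n + weight v r c)) (mon y r c)) R"
      by (rule colon_ideal[OF filt_ideal mon_closed])
    show "P \<subseteq> colon (filt P v (n + weight v r c)) (mon y r c)"
    proof
      fix x assume "x \<in> P"
      thus "x \<in> colon (filt P v (n + weight v r c)) (mon y r c)"
        using P P_subset_filt idealD(6)[OF filt_ideal mon_closed] unfolding colon_def by blast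
    qed
    show "mon y r b \<in> colon (filt P v (n + weight v r c)) (mon y r c)" if "n \<le> weight v r b" for b
      using that mon_mem_filt[of "n + weight v r c" "\<lambda>i. b i + c i"]
      by (simp add: colon_def mon_add weight_add)
  qed
  thus ?thesis using assms by (auto simp: colon_def)
qed

lemma ideal_power_subset_filt:
  assumes "\<And>i. i < r \<Longrightarrow> W \<le> v i"
  shows "ideal_power (Idl (y ` {..<r})) n \<subseteq> filt P v (W * n)"
proof (induction n)
  case 0
  have "weight v r (\<lambda>_. 0) = 0" "mon y r (\<lambda>_. 0) = \<one>" by (simp_all add: weight_def mon_def)
  hence "\<one> \<in> filt P v 0" using mon_mem_filt[of 0 "\<lambda>_. 0"] by simp
  hence "filt P v 0 = carrier R" by (rule ideal.one_imp_carrier[OF filt_ideal])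
  thus ?case by simp
next
  case (Suc n)
  have "x \<otimes> z \<in> filt P v (W * Suc n)" if x: "x \<in> filt P v (W * n)" and z: "z \<in> Idl (y ` {..<r})" for x z
  proof -
    have xc: "x \<in> carrier R" using x idealD(1)[OF filt_ideal] by blast
    have "y ` {..<r} \<subseteq> colon (filt P v (W * Suc n)) x"
    proof
      fix u assume "u \<in> y ` {..<r}"
      then obtain i where i: "i < r" "u = y i" by auto
      let ?e = "\<lambda>j. if i = j then 1 else 0"
      have "x \<otimes> mon y r ?e \<in> filt P v (W * n + weight v r ?e)" using x by (rule filt_mult)
      hence "x \<otimes> y i \<in> filt P v (W * n + v i)"
        using i y by (simp add: mon_single[OF i(1)] weight_single[OF i(1)])
      hence "x \<otimes> y i \<in> filt P v (W * Suc n)"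
        by (rule subsetD[OF filt_antimono, rotated]) (use assms[OF i(1)] in simp)
      thus "u \<in> colon (filt P v (W * Suc n)) x" using i xc y by (simp add: colon_def m_comm)
    qed
    hence "Idl (y ` {..<r}) \<subseteq> colon (filt P v (W * Suc n)) x"
      by (rule genideal_minimal[OF colon_ideal[OF filt_ideal xc]])
    hence "z \<otimes> x \<in> filt P v (W * Suc n)" "z \<in> carrier R" using z by (auto simp: colon_def)
    thus ?thesis using xc by (simp add: m_comm)
  qed
  hence "filt P v (W * n) \<cdot> (Idl (y ` {..<r})) \<subseteq> filt P v (W * Suc n)"
    by (rule ideal_prod_subset[OF filt_ideal])
  moreover have "ideal_power (Idl (y ` {..<r})) n \<cdot> (Idl (y ` {..<r})) \<subseteq> filt P v (W * n) \<cdot> (Idl (y ` {..<r}))"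
  proof -
    have "ideal (Idl (y ` {..<r})) R" using y by (intro genideal_ideal) auto
    from ideal_prod_is_ideal[OF filt_ideal this] show ?thesis
      by (rule ideal_prod_subset) (rule ideal_prod.prod[OF subsetD[OF Suc]])
  qed
  ultimately show ?case by simp
qed

text \<open>Call a monomial standard if it is not in \<open>filt\<close> of any larger weight. Every monomial is,
  modulo \<open>filt\<close> of a large weight, a combination of standard ones of at least its weight.\<close>

lemma standard_monomial_exists:
  assumes Q: "ideal Q R" "P \<subseteq> Q" "\<And>i. i < r \<Longrightarrow> y i [^] (q::nat) \<in> Q"
    and v: "\<And>i. i < r \<Longrightarrow> v i \<le> V"
    and n: "\<not> filt P v n \<subseteq> Q"
  shows "\<exists>a. mon y r a \<notin> filt P v (Suc (weight v r a)) \<and> n \<le> weight v r a \<and> (\<forall>i<r. a i < q)"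
proof (rule ccontr)
  assume no: "\<not> ?thesis"
  \<comment> \<open>A monomial with all exponents below \<open>q\<close> has weight at most
    \<open>r q V\<close>. From weight \<open>n0\<close> on, some exponent is at least
    \<open>q\<close>, and the monomial lies in \<open>Q\<close>.\<close>
  define n0 where "n0 = r * (q * V) + 1"
  have large: "filt P v k \<subseteq> Q" if "n0 \<le> k" for k
  proof (rule filt_subset[OF Q(1,2)])
    fix b assume b: "k \<le> weight v r b"
    have "\<exists>i<r. q \<le> b i"
    proof (rule ccontr)
      assume "\<not> ?thesis"
      hence "weight v r b \<le> (\<Sum>i<r. q * V)"
        unfolding weight_def using v by (intro sum_mono mult_mono) (auto simp: not_le less_imp_le)
      thus False using b that by (simp add: n0_def)
    qed
    thus "mon y r b \<in> Q" using mon_mem[OF Q(1) _ Q(3)] by blast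
  qed
  \<comment> \<open>Descending induction on \<open>k\<close>, starting at \<open>n0\<close>. A
    monomial of weight exactly \<open>k\<close> either lies in \<open>filt\<close> of weight
    \<open>k + 1\<close>, or is standard and then, by the negated claim, has an exponent at least
    \<open>q\<close>.\<close>
  have "filt P v k \<subseteq> Q" if "n \<le> k" for k
    using that
  proof (induction "n0 - k" arbitrary: k rule: less_induct)
    case less
    show ?case
    proof (cases "n0 \<le> k")
      case False
      have IH: "filt P v (Suc k) \<subseteq> Q" using less False by simp
      show ?thesis
      proof (rule filt_subset[OF Q(1,2)])
        fix b assume b: "k \<le> weight v r b"
        show "mon y r b \<in> Q"
        proof (cases "k = weight v r b")
          case True
          show ?thesis
          proof (cases "mon y r b \<in> filt P v (Suc k)")
            case False
            hence "\<exists>i<r. q \<le> b i" using no True less.prems by (auto simp: not_less)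
            thus ?thesis using mon_mem[OF Q(1) _ Q(3)] by blast
          qed (use IH in blast)
        next
          case False
          thus ?thesis using b IH mon_mem_filt[of "Suc k" b] by auto
        qed
      qed
    qed (rule large)
  qed
  thus False using n by blast
qed

text \<open>Multiplying by the complementary monomial preserves a gain in weight, so a nonstandard
  divisor would make the multiple nonstandard.\<close>

lemma standard_monomial_divisor:
  assumes "mon y r a \<notin> filt P v (Suc (weight v r a))" "\<And>i. b i \<le> a i"
  shows "mon y r b \<notin> filt P v (Suc (weight v r b))"
proof
  assume "mon y r b \<in> filt P v (Suc (weight v r b))"
  hence "mon y r b \<otimes> mon y r (\<lambda>i. a i - b i) \<in> filt P v (Suc (weight v r b) + weight v r (\<lambda>i. a i - b i))"
    by (rule filt_mult)
  moreover have "(\<lambda>i. b i + (a i - b i)) = a" using assms(2) by simp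
  ultimately show False
    using assms(1) mon_add[of b "\<lambda>i. a i - b i"] weight_add[of v r b "\<lambda>i. a i - b i"] by simp
qed

end
end
end

section \<open>Powers of \<open>m\<close> inside ideals that contain \<open>P\<close> and all
  \<open>q\<close>-th powers from \<open>m\<close>\<close>

lemma polynomial_growth_bound:
  fixes C D d :: nat
  shows "\<exists>t. C * (D * t) ^ d + 1 < (t + 1) ^ Suc d"
proof
  \<comment> \<open>With \<open>t = C D^d + 1\<close>, the left side is at most
    \<open>C D^d t^d + t^d = t^(d+1)\<close>.\<close>
  let ?t = "C * D ^ d + 1"
  have "C * (D * ?t) ^ d + 1 \<le> C * D ^ d * ?t ^ d + ?t ^ d"
    unfolding power_mult_distrib mult.assoc[symmetric] by (intro add_left_mono one_le_power) simp
  also have "\<dots> = ?t * ?t ^ d" by simp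
  also have "\<dots> < (?t + 1) * (?t + 1) ^ d"
    by (intro mult_less_le_imp_less power_mono) auto
  finally show "C * (D * ?t) ^ d + 1 < (?t + 1) ^ Suc d" by simp
qed

context noetherian_local_ring begin

text \<open>A monomial of degree at least \<open>d q + c\<close> with all exponents below \<open>q\<close> has \<open>d + 1\<close> exponents
  that are at least \<open>t\<close>. If it is standard, so are its divisors; the box of side \<open>t\<close> that they
  contain violates the polynomial growth of degree \<open>d\<close>.\<close>

lemma ideal_power_subset_bound:
  assumes P: "ideal P R" and d: "coheight_le P d"
  shows "\<exists>c. \<forall>q N Q. ideal Q R \<and> P \<subseteq> Q \<and> (\<forall>z\<in>m. z [^] (q::nat) \<in> Q) \<and> d * q + c \<le> N \<longrightarrow>
    ideal_power m N \<subseteq> Q"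
proof -
  obtain C where C: "\<And>M. length_le (P <+> ideal_power m M) (C * M ^ d)"
    using length_growth[OF assms] by blast
  obtain A where A: "A \<subseteq> carrier R" "finite A" "m = Idl A"
    using noetherian_ring.finetely_gen[OF noetherian m_ideal] by blast
  obtain y r where "A = y ` {i. i < (r::nat)}"
    using finite_imp_nat_seg_image_inj_on[OF A(2)] by blast
  hence m_eq: "m = Idl (y ` {..<r})" and y: "\<And>i. i < r \<Longrightarrow> y i \<in> carrier R"
    using A by (auto simp: lessThan_def)
  have y_m: "y i \<in> m" if "i < r" for i
    unfolding m_eq using that y genideal_self[of "y ` {..<r}"] by blast
  have Pc: "P \<subseteq> carrier R" using idealD(1)[OF P] .
  \<comment> \<open>Chosen for \<open>M = 2 (d+1) t\<close> below: a box with
    \<open>(t+1)^(d+1)\<close> points is larger than the set of \<open>C M^d + 1\<close> possible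
    ranks. Neither \<open>t\<close> nor \<open>r\<close> depends on \<open>q\<close>,
    \<open>N\<close> or \<open>Q\<close>, so the constant \<open>r t + 1\<close> is uniform.\<close>
  obtain t where t: "C * (2 * Suc d * t) ^ d + 1 < (t + 1) ^ Suc d"
    using polynomial_growth_bound by blast
  show ?thesis
  proof (intro exI[of _ "r * t + 1"] allI impI)
    fix q N Q
    assume Q: "ideal Q R \<and> P \<subseteq> Q \<and> (\<forall>z\<in>m. z [^] (q::nat) \<in> Q) \<and> d * q + (r * t + 1) \<le> N"
    \<comment> \<open>Each generator has weight \<open>W\<close> up to the small perturbation
      \<open>B^i\<close>. The weight is therefore \<open>W\<close> times the degree plus a number
      whose base \<open>B\<close> digits are the exponents, as long as these are at most
      \<open>t\<close>.\<close>
    define B where "B = t + 1"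
    define W where "W = Suc N * B ^ r"
    define v where "v i = W + B ^ i" for i
    let ?w = "weight v r" and ?F = "filt y r P v"
    note F_ideal = filt_ideal[OF y Pc]
    have v_le: "v i \<le> W + B ^ r" if "i < r" for i
      using that by (simp add: v_def B_def power_increasing)
    have BW: "B ^ r \<le> W" by (simp add: W_def)
    have w_eq: "?w b = W * (\<Sum>i<r. b i) + (\<Sum>i<r. b i * B ^ i)" for b
      by (simp add: weight_def v_def distrib_left sum.distrib sum_distrib_left mult.commute)
    have w_le: "?w b \<le> (W + B ^ r) * (\<Sum>i<r. b i)" for b
      unfolding weight_def sum_distrib_left
      by (intro sum_mono) (use v_le in \<open>simp add: mult.commute\<close>)
    show "ideal_power m N \<subseteq> Q"
    proof (rule ccontr)
      assume "\<not> ideal_power m N \<subseteq> Q"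
      moreover have "ideal_power m N \<subseteq> ?F (W * N)"
        unfolding m_eq by (rule ideal_power_subset_filt[OF y Pc]) (simp_all add: v_def)
      ultimately have "\<not> ?F (W * N) \<subseteq> Q" by blast
      then obtain a where a: "mon y r a \<notin> ?F (Suc (?w a))" "W * N \<le> ?w a" "\<forall>i<r. a i < q"
        using standard_monomial_exists[where y = y and r = r and Q = Q and q = q and v = v and V = "W + B ^ r" and n = "W * N", OF y Pc] Q y_m v_le by blast
      \<comment> \<open>A smaller degree would give weight at most \<open>(W + B^r)(N - 1)\<close>,
        which is below \<open>W N\<close> because \<open>W = (N+1) B^r\<close>.\<close>
      have deg: "N \<le> (\<Sum>i<r. a i)"
      proof (rule ccontr)
        assume "\<not> ?thesis"
        hence "Suc (\<Sum>i<r. a i) \<le> N" by simp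
        then obtain k where k: "N = Suc (\<Sum>i<r. a i) + k" using le_Suc_ex by blast
        have "W * N \<le> (W + B ^ r) * (\<Sum>i<r. a i)" using a(2) w_le le_trans by blast
        hence "W + W * k \<le> B ^ r * (\<Sum>i<r. a i)" using k by (simp add: algebra_simps)
        moreover have "B ^ r * (\<Sum>i<r. a i) < B ^ r * Suc N"
          using k by (intro mult_strict_left_mono) (auto simp: B_def)
        ultimately show False by (simp add: W_def mult.commute)
      qed
      define T where "T = {i \<in> {..<r}. t \<le> a i}"
      have T: "finite T" "T \<subseteq> {..<r}" by (auto simp: T_def)
      \<comment> \<open>Exponents in \<open>T\<close> are below \<open>q\<close> and the others
        below \<open>t\<close>, so otherwise the degree would be at most \<open>d q + r t\<close>,
        which is less than \<open>N\<close>.\<close>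
      have "Suc d \<le> card T"
      proof (rule ccontr)
        assume few: "\<not> Suc d \<le> card T"
        have "(\<Sum>i<r. a i) \<le> (\<Sum>i<r. (if i \<in> T then q else 0) + t)"
          using a(3) by (intro sum_mono) (auto simp: T_def less_imp_le trans_le_add1)
        also have "\<dots> = card T * q + r * t"
          using T by (simp add: sum.distrib sum.If_cases Int_absorb1)
        also have "\<dots> \<le> d * q + r * t" using few by simp
        finally show False using deg Q by simp
      qed
      then obtain S where S: "S \<subseteq> T" "card S = Suc d" "finite S"
        using obtain_subset_with_card_n by metis
      define Box where "Box = PiE S (\<lambda>_. {..t})"
      define ext where "ext g = (\<lambda>i. if i \<in> S then g i else 0 :: nat)" for g
      have ext_le: "ext g i \<le> t" if "g \<in> Box" for g i
        using that by (auto simp: ext_def Box_def PiE_def Pi_def)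
      have std: "mon y r (ext g) \<notin> ?F (Suc (?w (ext g)))" if "g \<in> Box" for g
      proof (rule standard_monomial_divisor[OF y Pc a(1)])
        show "ext g i \<le> a i" for i
          using ext_le[OF that, of i] S(1) by (auto simp: ext_def T_def)
      qed
      \<comment> \<open>The weight of \<open>ext g\<close> is at most
        \<open>(W + B^r)(d+1)t\<close>, and \<open>B^r \<le> W\<close> makes this at most
        \<open>W M\<close>. So the \<open>filt\<close> ideal at this weight contains
        \<open>m^M\<close> and falls under the length bound.\<close>
      define M where "M = 2 * Suc d * t"
      have w_ext: "?w (ext g) \<le> W * M" if "g \<in> Box" for g
      proof -
        have "(\<Sum>i<r. ext g i) = (\<Sum>i\<in>S. ext g i)"
          using S T by (intro sum.mono_neutral_right) (auto simp: ext_def)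
        also have "\<dots> \<le> Suc d * t" using sum_bounded_above[of S "ext g" t] ext_le[OF that] S(2) by simp
        finally have "?w (ext g) \<le> (W + B ^ r) * (Suc d * t)" using w_le le_trans mult_le_mono2 by blast
        also have "\<dots> \<le> (2 * W) * (Suc d * t)" using BW by (intro mult_le_mono1) simp
        finally show ?thesis by (simp add: M_def algebra_simps)
      qed
      have U: "P <+> ideal_power m M \<subseteq> ?F (?w (ext g))" if "g \<in> Box" for g
      proof -
        have "ideal_power m M \<subseteq> ?F (W * M)"
          unfolding m_eq by (rule ideal_power_subset_filt[OF y Pc]) (simp_all add: v_def)
        also have "\<dots> \<subseteq> ?F (?w (ext g))" by (rule filt_antimono[OF y Pc w_ext[OF that]])
        finally show ?thesis
          using sum_subset_iff[OF P ideal_power_ideal[OF m_ideal] F_ideal] P_subset_filt[OF y Pc] by simp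
      qed
      obtain \<rho> where \<rho>: "\<And>K. ideal K R \<Longrightarrow> P <+> ideal_power m M \<subseteq> K \<Longrightarrow> \<rho> K \<le> C * M ^ d"
        "\<And>K K'. ideal K R \<Longrightarrow> ideal K' R \<Longrightarrow> P <+> ideal_power m M \<subseteq> K \<Longrightarrow> K \<subset> K' \<Longrightarrow> \<rho> K < (\<rho> K' :: nat)"
        using length_le_rank[OF C[of M]] by metis
      define f where "f g = \<rho> (?F (?w (ext g)))" for g
      \<comment> \<open>Since \<open>ext g\<close> is standard, its monomial separates the two
        \<open>filt\<close> ideals, which are therefore strictly nested.\<close>
      have f_less: "f g' < f g" if "g \<in> Box" "g' \<in> Box" "?w (ext g) < ?w (ext g')" for g g'
      proof -
        have "?F (?w (ext g')) \<subseteq> ?F (Suc (?w (ext g)))" "?F (Suc (?w (ext g))) \<subseteq> ?F (?w (ext g))"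
          by (rule filt_antimono[OF y Pc]; use that in simp)+
        moreover have "mon y r (ext g) \<in> ?F (?w (ext g))" by (rule mon_mem_filt[OF y Pc]) simp_all
        ultimately have "?F (?w (ext g')) \<subset> ?F (?w (ext g))" using std[OF that(1)] by blast
        thus ?thesis unfolding f_def by (intro \<rho>(2) F_ideal U that)
      qed
      have "inj_on f Box"
      proof (rule inj_onI)
        fix g g' assume g: "g \<in> Box" "g' \<in> Box" "f g = f g'"
        hence w: "?w (ext g) = ?w (ext g')" using f_less[of g g'] f_less[of g' g] by (metis less_irrefl linorder_neqE_nat)
        \<comment> \<open>The digit sum is less than \<open>B^r \<le> W\<close>, so reducing the
          weight modulo \<open>W\<close> removes the degree term and leaves the digits.\<close>
        have dig: "(\<Sum>i<r. ext h i * B ^ i) < W" if "h \<in> Box" for h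
          using sum_digits_less[of r "ext h" B] ext_le[OF that] BW by (force simp: B_def less_Suc_eq_le)
        have "?w (ext h) mod W = (\<Sum>i<r. ext h i * B ^ i)" if "h \<in> Box" for h
          using dig[OF that] by (simp add: w_eq)
        hence eq: "(\<Sum>i<r. ext g i * B ^ i) = (\<Sum>i<r. ext g' i * B ^ i)" using w g by metis
        have "ext g i = ext g' i" if "i < r" for i
          by (rule sum_digits_inj[OF _ _ eq that]) (use ext_le g in \<open>auto simp: B_def less_Suc_eq_le\<close>)
        hence "g i = g' i" if "i \<in> S" for i
          using that S(1) T(2) by (auto simp: ext_def) (metis (no_types, lifting) lessThan_iff subsetD)
        thus "g = g'" using g(1,2) unfolding Box_def by (intro PiE_ext)
      qed
      moreover have "f ` Box \<subseteq> {..C * M ^ d}" using \<rho>(1)[OF F_ideal U] by (auto simp: f_def)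
      ultimately have "card Box \<le> card {..C * M ^ d}" by (intro card_inj_on_le) auto
      moreover have "card Box = (t + 1) ^ Suc d" unfolding Box_def using S by (simp add: card_PiE)
      ultimately show False using t by (simp add: M_def)
    qed
  qed
qed

end

section \<open>The splitting prime\<close>

text \<open>The \<open>p^(-e)\<close>-linear maps, elements of \<open>Hom(F^e_*(R), R)\<close>. As
  \<open>F^e_*(R)\<close> has the elements of \<open>R\<close>, they are additive self-maps of
  \<open>R\<close> and can be composed.\<close>

definition cartier_maps :: "('a, 'b) ring_scheme \<Rightarrow> nat \<Rightarrow> nat \<Rightarrow> ('a \<Rightarrow> 'a) set" where
  "cartier_maps R p e = module_hom R (frobenius_module p e R) (self_module R)"

lemma cartier_maps_iff:
  fixes R (structure)
  shows "\<phi> \<in> cartier_maps R p e \<longleftrightarrow> \<phi> \<in> carrier R \<rightarrow> carrier R \<and>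
    (\<forall>x\<in>carrier R. \<forall>y\<in>carrier R. \<phi> (x \<oplus> y) = \<phi> x \<oplus> \<phi> y) \<and>
    (\<forall>r\<in>carrier R. \<forall>x\<in>carrier R. \<phi> (r [^] (p ^ e) \<otimes> x) = r \<otimes> \<phi> x)"
  by (simp add: cartier_maps_def module_hom_def frobenius_module_def self_module_def)

context cring begin

lemma cartier_mapsD:
  assumes "\<phi> \<in> cartier_maps R p e"
  shows "x \<in> carrier R \<Longrightarrow> \<phi> x \<in> carrier R"
    "x \<in> carrier R \<Longrightarrow> y \<in> carrier R \<Longrightarrow> \<phi> (x \<oplus> y) = \<phi> x \<oplus> \<phi> y"
    "r \<in> carrier R \<Longrightarrow> x \<in> carrier R \<Longrightarrow> \<phi> (r [^] (p ^ e) \<otimes> x) = r \<otimes> \<phi> x"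
    "\<phi> \<zero> = \<zero>"
proof -
  have *: "\<phi> \<in> carrier R \<rightarrow> carrier R" "\<forall>x\<in>carrier R. \<forall>y\<in>carrier R. \<phi> (x \<oplus> y) = \<phi> x \<oplus> \<phi> y"
    "\<forall>r\<in>carrier R. \<forall>x\<in>carrier R. \<phi> (r [^] (p ^ e) \<otimes> x) = r \<otimes> \<phi> x"
    using assms by (simp_all add: cartier_maps_iff)
  show "x \<in> carrier R \<Longrightarrow> \<phi> x \<in> carrier R"
    "x \<in> carrier R \<Longrightarrow> y \<in> carrier R \<Longrightarrow> \<phi> (x \<oplus> y) = \<phi> x \<oplus> \<phi> y"
    "r \<in> carrier R \<Longrightarrow> x \<in> carrier R \<Longrightarrow> \<phi> (r [^] (p ^ e) \<otimes> x) = r \<otimes> \<phi> x"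
    using * by auto
  have "\<phi> \<zero> = \<phi> (\<zero> [^] (p ^ e) \<otimes> \<zero>)" by simp
  also have "\<dots> = \<zero> \<otimes> \<phi> \<zero>" using *(3) by blast
  finally show "\<phi> \<zero> = \<zero>" using funcset_mem[OF *(1) zero_closed] by simp
qed

lemma cartier_maps_id: "(\<lambda>x. x) \<in> cartier_maps R p 0"
  by (simp add: cartier_maps_iff)

lemma cartier_maps_comp:
  assumes "\<phi> \<in> cartier_maps R p e" "\<psi> \<in> cartier_maps R p e'"
  shows "(\<lambda>x. \<phi> (\<psi> x)) \<in> cartier_maps R p (e + e')"
  unfolding cartier_maps_iff
  using cartier_mapsD[OF assms(1)] cartier_mapsD[OF assms(2)]
  by (auto simp: power_add nat_pow_pow[symmetric])

lemma cartier_maps_premult: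
  assumes "\<phi> \<in> cartier_maps R p e" "a \<in> carrier R"
  shows "(\<lambda>x. \<phi> (a \<otimes> x)) \<in> cartier_maps R p e"
  unfolding cartier_maps_iff
  using cartier_mapsD[OF assms(1)] assms(2) by (auto simp: r_distr m_lcomm[of a])

lemma cartier_maps_postmult:
  assumes "\<phi> \<in> cartier_maps R p e" "a \<in> carrier R"
  shows "(\<lambda>x. a \<otimes> \<phi> x) \<in> cartier_maps R p e"
  unfolding cartier_maps_iff
  using cartier_mapsD[OF assms(1)] assms(2) by (auto simp: r_distr m_lcomm[of a])

end

section \<open>The splitting prime of an F-pure local ring\<close>

locale F_pure_local_ring = noetherian_local_ring +
  fixes p :: nat
  assumes prime_p: "prime p" and F_pure: "F_pure p R"
begin

lemma F_finite: "F_finite p R"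
  using F_pure by (simp add: F_pure_def)

text \<open>Both are contained in \<open>F_pure\<close>: a splitting is a
  \<open>p^(-1)\<close>-linear left inverse of Frobenius, and \<open>splits\<close> includes that
  Frobenius itself is additive.\<close>

lemma frobenius_splitting: "\<exists>\<pi>\<in>cartier_maps R p 1. \<forall>x\<in>carrier R. \<pi> (x [^] p) = x"
  and frobenius_add: "x \<in> carrier R \<Longrightarrow> y \<in> carrier R \<Longrightarrow> (x \<oplus> y) [^] p = x [^] p \<oplus> y [^] p"
  using F_pure by (auto simp: F_pure_def splits_def cartier_maps_def)
    (auto simp: module_hom_def frobenius_module_def self_module_def)

lemma p_ge_2: "p \<ge> 2"
  using prime_p by (rule prime_ge_2_nat)

lemma p_pow_pos: "p ^ e > 0"
  using p_ge_2 by simp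

text \<open>Premultiplying by \<open>x^(p^e - 1)\<close> turns an argument \<open>x\<close> into a
  \<open>p^e\<close>-th power, from which a \<open>p^(-e)\<close>-linear map extracts
  \<open>x\<close>.\<close>

lemma pow_p_pow: "x \<in> carrier R \<Longrightarrow> x [^] (p ^ e) = x [^] (p ^ e - 1) \<otimes> x"
  using p_pow_pos[of e] nat_pow_Suc[of x "p ^ e - 1"] by simp

text \<open>The Aberbach--Enescu splitting prime.\<close>

definition splitting_prime :: "'a set" where
  "splitting_prime = {c \<in> carrier R. \<forall>e. \<forall>\<phi>\<in>cartier_maps R p e. \<phi> c \<in> m}"

lemma splitting_prime_ideal: "ideal splitting_prime R"
proof (rule idealI_cring)
  show "\<zero> \<in> splitting_prime"
  proof -
    have "\<phi> \<zero> \<in> m" if "\<phi> \<in> cartier_maps R p e" for e \<phi>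
      using cartier_mapsD(4)[OF that] idealD(2)[OF m_ideal] by simp
    thus ?thesis by (simp add: splitting_prime_def)
  qed
  show "x \<oplus> y \<in> splitting_prime" if "x \<in> splitting_prime" "y \<in> splitting_prime" for x y
  proof -
    have xy: "x \<in> carrier R" "y \<in> carrier R" using that by (auto simp: splitting_prime_def)
    have "\<phi> (x \<oplus> y) \<in> m" if \<phi>: "\<phi> \<in> cartier_maps R p e" for e \<phi>
      using cartier_mapsD(2)[OF \<phi> xy] idealD(3)[OF m_ideal] \<phi> \<open>x \<in> splitting_prime\<close> \<open>y \<in> splitting_prime\<close>
      by (auto simp: splitting_prime_def)
    thus ?thesis using xy by (simp add: splitting_prime_def)
  qed
  show "r \<otimes> x \<in> splitting_prime" if "r \<in> carrier R" "x \<in> splitting_prime" for r x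
  proof -
    have "\<phi> (r \<otimes> x) \<in> m" if "\<phi> \<in> cartier_maps R p e" for e \<phi>
      using cartier_maps_premult[OF that \<open>r \<in> carrier R\<close>] \<open>x \<in> splitting_prime\<close>
      by (auto simp: splitting_prime_def)
    thus ?thesis using that by (simp add: splitting_prime_def)
  qed
qed (auto simp: splitting_prime_def)

lemma splitting_prime_compatible:
  assumes "\<phi> \<in> cartier_maps R p e" "c \<in> splitting_prime"
  shows "\<phi> c \<in> splitting_prime"
proof -
  have "\<psi> (\<phi> c) \<in> m" if "\<psi> \<in> cartier_maps R p e'" for e' \<psi>
    using cartier_maps_comp[OF that assms(1)] assms(2) by (auto simp: splitting_prime_def)
  thus ?thesis using assms cartier_mapsD(1)[OF assms(1)] by (simp add: splitting_prime_def)
qed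

lemma splitting_prime_subset_m: "splitting_prime \<subseteq> m"
  using cartier_maps_id by (fastforce simp: splitting_prime_def)

text \<open>Some \<open>\<phi> u\<close> is a unit, normalized by its inverse \<open>v\<close>.
  Composing with \<open>\<pi> (u^(p-1) x)\<close>, a map that fixes \<open>u\<close>, makes the
  exponent positive.\<close>

lemma notin_splitting_prime:
  assumes "u \<in> carrier R" "u \<notin> splitting_prime"
  shows "\<exists>e>0. \<exists>\<phi>\<in>cartier_maps R p e. \<phi> u = \<one>"
proof -
  obtain e \<phi> where \<phi>: "\<phi> \<in> cartier_maps R p e" "\<phi> u \<notin> m"
    using assms by (auto simp: splitting_prime_def)
  obtain v where v: "v \<in> carrier R" "v \<otimes> \<phi> u = \<one>"
    using unit_if_notin_m[OF cartier_mapsD(1)[OF \<phi>(1) assms(1)] \<phi>(2)] by blast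
  obtain \<pi> where \<pi>: "\<pi> \<in> cartier_maps R p 1" "\<And>x. x \<in> carrier R \<Longrightarrow> \<pi> (x [^] p) = x"
    using frobenius_splitting by blast
  let ?a = "u [^] (p - 1)"
  let ?\<theta> = "\<lambda>x. v \<otimes> \<phi> (\<pi> (?a \<otimes> x))"
  have "?\<theta> \<in> cartier_maps R p (e + 1)"
    using cartier_maps_postmult[OF cartier_maps_comp[OF \<phi>(1) cartier_maps_premult[OF \<pi>(1), of ?a]] v(1)]
      assms(1) by simp
  moreover have "?a \<otimes> u = u [^] p" using pow_p_pow[of u 1] assms(1) by simp
  hence "?\<theta> u = \<one>" using \<pi>(2)[OF assms(1)] v(2) by simp
  ultimately show ?thesis by (intro exI[of _ "e + 1"]) auto
qed

text \<open>If \<open>\<phi> a = 1\<close> and \<open>\<psi> b = 1\<close>, then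
  \<open>\<psi> (a^(p^e') b) = a\<close>, so premultiplying by \<open>a^(p^e' - 1)\<close> and
  applying \<open>\<psi>\<close>, then \<open>\<phi>\<close>, sends \<open>a b\<close> to 1.\<close>

lemma splitting_prime_prime: "primeideal splitting_prime R"
proof (rule primeidealI[OF splitting_prime_ideal cring_axioms])
  show "carrier R \<noteq> splitting_prime"
    using splitting_prime_subset_m one_notin_m by blast
  fix a b assume ab: "a \<in> carrier R" "b \<in> carrier R" "a \<otimes> b \<in> splitting_prime"
  show "a \<in> splitting_prime \<or> b \<in> splitting_prime"
  proof (rule ccontr)
    assume "\<not> ?thesis"
    then obtain e \<phi> e' \<psi> where \<phi>: "\<phi> \<in> cartier_maps R p e" "\<phi> a = \<one>"
      and \<psi>: "\<psi> \<in> cartier_maps R p e'" "\<psi> b = \<one>"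
      using notin_splitting_prime ab by metis
    let ?c = "a [^] (p ^ e' - 1)"
    have "(\<lambda>x. \<phi> (\<psi> (?c \<otimes> x))) \<in> cartier_maps R p (e + e')"
      using cartier_maps_comp[OF \<phi>(1) cartier_maps_premult[OF \<psi>(1), of ?c]] ab by simp
    hence "\<phi> (\<psi> (?c \<otimes> (a \<otimes> b))) \<in> m" using ab(3) by (auto simp: splitting_prime_def)
    moreover have "?c \<otimes> (a \<otimes> b) = a [^] (p ^ e') \<otimes> b"
      using ab by (simp add: pow_p_pow m_assoc)
    hence "\<psi> (?c \<otimes> (a \<otimes> b)) = a" using cartier_mapsD(3)[OF \<psi>(1)] \<psi>(2) ab by simp
    ultimately show False using \<phi>(2) one_notin_m by simp
  qed
qed

text \<open>With \<open>\<phi> u = 1\<close> one has \<open>x = \<phi> (x^(p^e) u)\<close>, and the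
  argument is a multiple of \<open>u x = 0\<close>.\<close>

lemma splitting_prime_nonzerodivisor:
  assumes "u \<in> carrier R" "u \<notin> splitting_prime" "x \<in> carrier R" "u \<otimes> x = \<zero>"
  shows "x = \<zero>"
proof -
  obtain e \<phi> where \<phi>: "\<phi> \<in> cartier_maps R p e" "\<phi> u = \<one>"
    using notin_splitting_prime assms by blast
  have "x [^] (p ^ e) \<otimes> u = x [^] (p ^ e - 1) \<otimes> (u \<otimes> x)"
    using assms(1,3) by (simp add: pow_p_pow m_assoc m_comm[of x u])
  hence "\<phi> (x [^] (p ^ e) \<otimes> u) = \<zero>" using assms cartier_mapsD(4)[OF \<phi>(1)] by simp
  thus ?thesis using cartier_mapsD(3)[OF \<phi>(1) assms(3,1)] \<phi>(2) assms(3) by simp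
qed

lemma strongly_F_regular_if_splitting_prime_zero:
  assumes "splitting_prime = {\<zero>}"
  shows "strongly_F_regular p R"
proof -
  have "domain R"
  proof (rule domainI[OF cring_axioms])
    show "\<one> \<noteq> \<zero>" using one_notin_m idealD(2)[OF m_ideal] by auto
    show "a = \<zero> \<or> b = \<zero>" if "a \<otimes> b = \<zero>" "a \<in> carrier R" "b \<in> carrier R" for a b
      using that assms splitting_prime_nonzerodivisor by blast
  qed
  thus ?thesis
    using F_finite notin_splitting_prime assms
    by (auto simp: strongly_F_regular_def cartier_maps_def)
qed

section \<open>The F-pure threshold and the height of the splitting prime\<close>

lemma fpt_le_coheight:
  assumes d: "coheight_le splitting_prime d"
  shows "fpt p R m \<le> ereal (real d)"
  unfolding fpt_def
proof (rule Sup_least)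
  fix x assume "x \<in> {ereal l |l. 0 \<le> l \<and> F_pure_pair p R m l}"
  then obtain l where l: "x = ereal l" "0 \<le> l" "F_pure_pair p R m l" by blast
  obtain c where c: "\<And>q N Q. ideal Q R \<Longrightarrow> splitting_prime \<subseteq> Q \<Longrightarrow> (\<And>z. z \<in> m \<Longrightarrow> z [^] (q::nat) \<in> Q) \<Longrightarrow>
      d * q + c \<le> N \<Longrightarrow> ideal_power m N \<subseteq> Q"
    using ideal_power_subset_bound[OF splitting_prime_ideal d] by metis
  obtain e0 where e0: "\<And>e. e \<ge> e0 \<Longrightarrow> \<exists>f\<in>ideal_power m (nat \<lfloor>l * (real p ^ e - 1)\<rfloor>).
      splits R (self_module R) (frobenius_module p e R) (\<lambda>r. r \<odot>\<^bsub>frobenius_module p e R\<^esub> f)"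
    using l(3) unfolding F_pure_pair_def eventually_sequentially ideal_power_def by blast
  have bound: "l * (real p ^ e - 1) < real d * real p ^ e + real c + 1" if e: "e \<ge> e0" for e
  proof -
    let ?N = "nat \<lfloor>l * (real p ^ e - 1)\<rfloor>"
    obtain f \<phi> where f: "f \<in> ideal_power m ?N" and \<phi>: "\<phi> \<in> cartier_maps R p e"
      and \<phi>f: "\<And>x. x \<in> carrier R \<Longrightarrow> \<phi> (x [^] (p ^ e) \<otimes> f) = x"
      using e0[OF e] by (auto simp: splits_def cartier_maps_def self_module_def frobenius_module_def)
    have fc: "f \<in> carrier R" using f idealD(1)[OF ideal_power_ideal[OF m_ideal]] by blast
    have "\<phi> f = \<one>" using \<phi>f[of \<one>] fc by simp
    \<comment> \<open>The largest ideal that \<open>\<phi>\<close> maps into \<open>m\<close>. It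
      contains the splitting prime, which is stable under \<open>\<phi>\<close>, and
      \<open>z^(p^e)\<close> for \<open>z\<close> in \<open>m\<close>, as
      \<open>\<phi> (r z^(p^e)) = z \<phi> r\<close>; it does not contain \<open>f\<close>, as
      \<open>\<phi> f = 1\<close>.\<close>
    define Q where "Q = {x \<in> carrier R. \<forall>r\<in>carrier R. \<phi> (r \<otimes> x) \<in> m}"
    note \<phi>D = cartier_mapsD[OF \<phi>]
    have Q: "ideal Q R"
    proof (rule idealI_cring)
      show "x \<oplus> y \<in> Q" if "x \<in> Q" "y \<in> Q" for x y
        using that \<phi>D(2) idealD(3)[OF m_ideal] by (auto simp: Q_def r_distr)
      show "r \<otimes> x \<in> Q" if "r \<in> carrier R" "x \<in> Q" for r x
        using that by (auto simp: Q_def m_assoc[symmetric])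
    qed (use \<phi>D(4) idealD(2)[OF m_ideal] in \<open>auto simp: Q_def\<close>)
    have PQ: "splitting_prime \<subseteq> Q"
    proof
      fix x assume x: "x \<in> splitting_prime"
      have "\<phi> (r \<otimes> x) \<in> m" if "r \<in> carrier R" for r
        using splitting_prime_compatible[OF \<phi>] idealD(5)[OF splitting_prime_ideal that x]
          splitting_prime_subset_m by blast
      thus "x \<in> Q" using x by (simp add: Q_def splitting_prime_def)
    qed
    have mQ: "z [^] (p ^ e) \<in> Q" if "z \<in> m" for z
    proof -
      have z: "z \<in> carrier R" using that m_subset by blast
      have "\<phi> (r \<otimes> z [^] (p ^ e)) \<in> m" if r: "r \<in> carrier R" for r
      proof -
        have "\<phi> (r \<otimes> z [^] (p ^ e)) = z \<otimes> \<phi> r" using \<phi>D(3)[OF z r] r z by (simp add: m_comm)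
        thus ?thesis using idealD(6)[OF m_ideal \<phi>D(1)[OF r] \<open>z \<in> m\<close>] by simp
      qed
      thus ?thesis using z by (simp add: Q_def)
    qed
    have "\<not> ideal_power m ?N \<subseteq> Q"
    proof
      assume "ideal_power m ?N \<subseteq> Q"
      hence "\<phi> (\<one> \<otimes> f) \<in> m" using f by (auto simp: Q_def)
      thus False using \<open>\<phi> f = \<one>\<close> one_notin_m fc by simp
    qed
    hence "?N < d * p ^ e + c" using c[OF Q PQ mQ] by (meson not_less)
    moreover have "l * (real p ^ e - 1) < real ?N + 1" using real_nat_ceiling_ge by linarith
    ultimately have "l * (real p ^ e - 1) < real (d * p ^ e + c) + 1"
      by (smt (verit, best) of_nat_less_iff)
    thus ?thesis by simp
  qed
  \<comment> \<open>With \<open>q = p^e\<close>, the bound reads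
    \<open>q (l - d) < c + 1 + l\<close> for all large \<open>e\<close>; this fails for
    \<open>l > d\<close> because \<open>q \<ge> 2^e\<close> is unbounded.\<close>
  have "l \<le> real d"
  proof (rule ccontr)
    assume "\<not> ?thesis"
    hence ld: "l - real d > 0" by simp
    obtain n where n: "(real c + 1 + l) / (l - real d) < 2 ^ n"
      using real_arch_pow[of 2] by auto
    let ?e = "max n e0"
    have "(2::real) ^ n \<le> 2 ^ ?e" by (intro power_increasing) auto
    also have "\<dots> \<le> real p ^ ?e" using p_ge_2 by (intro power_mono) auto
    finally have "(real c + 1 + l) / (l - real d) < real p ^ ?e" using n by simp
    hence "real c + 1 + l < real p ^ ?e * (l - real d)" using ld by (simp add: pos_divide_less_eq)
    thus False using bound[of ?e] by (simp add: algebra_simps)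
  qed
  thus "x \<le> ereal (real d)" using l by simp
qed

text \<open>A chain of length \<open>n\<close> below the splitting prime \<open>P\<close> and one of
  length \<open>dim(R/P)\<close> above it join to a chain in \<open>R\<close>, so
  \<open>n \<le> dim(R) - dim(R/P) \<le> dfpt(R) < k + 1\<close>.\<close>

lemma height_splitting_prime_le:
  assumes "dfpt p R m < ereal (real k + 1)"
    and Q: "\<And>i. i \<le> n \<Longrightarrow> primeideal (Q i) R" "\<And>i. i < n \<Longrightarrow> Q i \<subset> Q (Suc i)" "Q n \<subseteq> splitting_prime"
  shows "n \<le> k"
proof -
  have "krull_dim R \<noteq> \<infinity>"
  proof
    assume "krull_dim R = \<infinity>"
    \<comment> \<open>Extended reals have \<open>\<infinity> - \<infinity> = \<infinity>\<close>, so
      infinite dimension makes \<open>dfpt\<close> infinite whatever the threshold is.\<close>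
    thus False using assms(1) by (cases "fpt p R m") (simp_all add: dfpt_def)
  qed
  then obtain D where D: "krull_dim R = enat D" by auto
  have chain: "n \<le> D" if "\<forall>i\<le>n. primeideal (Q i) R" "\<forall>i<n. Q i \<subset> Q (Suc i)" for n Q
  proof -
    have "enat n \<le> krull_dim R" unfolding krull_dim_def by (rule Sup_upper) (use that in blast)
    thus ?thesis using D by simp
  qed
  hence "coheight_le splitting_prime D" by (auto simp: coheight_le_def)
  \<comment> \<open>The least bound is attained by a chain of exactly \<open>d\<close> inclusions,
    which can then be joined to \<open>Q\<close>.\<close>
  define d where "d = (LEAST d. coheight_le splitting_prime d)"
  have d: "coheight_le splitting_prime d"
    unfolding d_def using \<open>coheight_le splitting_prime D\<close> by (rule LeastI)
  have "\<exists>Z. (\<forall>i\<le>d. primeideal (Z i) R \<and> splitting_prime \<subseteq> Z i) \<and> (\<forall>i<d. Z i \<subset> Z (Suc i))"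
  proof (cases d)
    case 0
    thus ?thesis using splitting_prime_prime by (intro exI[of _ "\<lambda>_. splitting_prime"]) simp
  next
    case (Suc d')
    hence "\<not> coheight_le splitting_prime d'" using not_less_Least[of d' "coheight_le splitting_prime"] d_def by simp
    then obtain n Z where Z: "(\<forall>i\<le>n. primeideal (Z i) R \<and> splitting_prime \<subseteq> Z i) \<and> (\<forall>i<n. Z i \<subset> Z (Suc i))"
      "\<not> n \<le> d'" unfolding coheight_le_def by blast
    moreover from this have "n \<le> d" using d unfolding coheight_le_def by blast
    ultimately have "n = d" using Suc by simp
    thus ?thesis using Z by blast
  qed
  then obtain Z where Z: "\<forall>i\<le>d. primeideal (Z i) R \<and> splitting_prime \<subseteq> Z i" "\<forall>i<d. Z i \<subset> Z (Suc i)"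
    by blast
  \<comment> \<open>\<open>Z 0\<close> takes the place of \<open>Q n\<close>, which lies in the
    splitting prime and hence in \<open>Z 0\<close>; the \<open>n + d\<close> inclusions stay
    strict.\<close>
  define W where "W i = (if i < n then Q i else Z (i - n))" for i
  have "n + d \<le> D"
  proof (rule chain)
    show "\<forall>i\<le>n + d. primeideal (W i) R" using Q(1) Z(1) by (auto simp: W_def)
    show "\<forall>i<n + d. W i \<subset> W (Suc i)"
    proof (intro allI impI)
      fix i assume i: "i < n + d"
      consider "Suc i < n" | "Suc i = n" | "n \<le> i" by linarith
      thus "W i \<subset> W (Suc i)"
      proof cases
        case 2
        have "Q i \<subset> Q (Suc i)" using Q(2)[of i] 2 by linarith
        also have "Q (Suc i) \<subseteq> Z 0" using 2 Q(3) Z(1) by blast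
        finally have "Q i \<subset> Z 0" .
        moreover have "W i = Q i" "W (Suc i) = Z 0" using 2 by (auto simp: W_def)
        ultimately show ?thesis by simp
      next
        case 3
        thus ?thesis using Z(2) i by (auto simp: W_def Suc_diff_le)
      qed (use Q(2) in \<open>auto simp: W_def\<close>)
    qed
  qed
  have "ereal (real D - real d) \<le> ereal (real D) - fpt p R m"
    using ereal_minus_mono[OF order_refl fpt_le_coheight[OF d], of "ereal (real D)"] by simp
  also have "\<dots> < ereal (real k + 1)" using assms(1) D by (simp add: dfpt_def)
  finally have "real D - real d < real k + 1" by simp
  thus ?thesis using \<open>n + d \<le> D\<close> by simp
qed

end

section \<open>Localization\<close>

locale mult_set = cring R for R (structure) +
  fixes S
  assumes S_subset: "S \<subseteq> carrier R" and S_one: "\<one> \<in> S"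
    and S_mult: "s \<in> S \<Longrightarrow> t \<in> S \<Longrightarrow> s \<otimes> t \<in> S"
begin

abbreviation L where "L \<equiv> localization R S"

abbreviation frac where "frac \<equiv> fraction R S"

lemma S_closed [simp]: "s \<in> S \<Longrightarrow> s \<in> carrier R"
  using S_subset by blast

lemma frac_rel_equiv: "equiv (carrier R \<times> S) (frac_rel R S)"
proof (rule equivI)
  show "frac_rel R S \<subseteq> (carrier R \<times> S) \<times> (carrier R \<times> S)" by (auto simp: frac_rel_def)
  show "refl_on (carrier R \<times> S) (frac_rel R S)"
    by (rule refl_onI) (use S_one in \<open>auto simp: frac_rel_def\<close>)
  show "sym (frac_rel R S)"
  proof (rule symI)
    fix x y assume "(x, y) \<in> frac_rel R S"
    then obtain a s b t u where "x = (a, s)" "y = (b, t)"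
      "a \<in> carrier R" "s \<in> S" "b \<in> carrier R" "t \<in> S" "u \<in> S" "u \<otimes> (t \<otimes> a) = u \<otimes> (s \<otimes> b)"
      by (auto simp: frac_rel_def)
    thus "(y, x) \<in> frac_rel R S" by (auto simp: frac_rel_def intro!: bexI[of _ u])
  qed
  show "trans (frac_rel R S)"
  proof (rule transI)
    fix x y z assume "(x, y) \<in> frac_rel R S" "(y, z) \<in> frac_rel R S"
    then obtain a s b t c w u v where *: "x = (a, s)" "y = (b, t)" "z = (c, w)"
      "a \<in> carrier R" "s \<in> S" "b \<in> carrier R" "t \<in> S" "c \<in> carrier R" "w \<in> S" "u \<in> S" "v \<in> S"
      "u \<otimes> (t \<otimes> a) = u \<otimes> (s \<otimes> b)" "v \<otimes> (w \<otimes> b) = v \<otimes> (t \<otimes> c)"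
      by (auto simp: frac_rel_def)
    have "(u \<otimes> v \<otimes> t) \<otimes> (w \<otimes> a) = v \<otimes> w \<otimes> (u \<otimes> (t \<otimes> a))" using *(4-11) by (simp add: m_ac)
    also have "\<dots> = v \<otimes> w \<otimes> (u \<otimes> (s \<otimes> b))" using *(12) by simp
    also have "\<dots> = u \<otimes> s \<otimes> (v \<otimes> (w \<otimes> b))" using *(4-11) by (simp add: m_ac)
    also have "\<dots> = u \<otimes> s \<otimes> (v \<otimes> (t \<otimes> c))" using *(13) by simp
    also have "\<dots> = (u \<otimes> v \<otimes> t) \<otimes> (s \<otimes> c)" using *(4-11) by (simp add: m_ac)
    finally have "(u \<otimes> v \<otimes> t) \<otimes> (w \<otimes> a) = (u \<otimes> v \<otimes> t) \<otimes> (s \<otimes> c)" .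
    moreover have "u \<otimes> v \<otimes> t \<in> S" using * S_mult by simp
    ultimately show "(x, z) \<in> frac_rel R S" using * by (auto simp: frac_rel_def)
  qed
qed

lemma frac_eq_iff:
  assumes "a \<in> carrier R" "s \<in> S" "b \<in> carrier R" "t \<in> S"
  shows "frac a s = frac b t \<longleftrightarrow> (\<exists>u\<in>S. u \<otimes> (t \<otimes> a) = u \<otimes> (s \<otimes> b))"
proof -
  have "frac a s = frac b t \<longleftrightarrow> ((a, s), (b, t)) \<in> frac_rel R S"
    unfolding fraction_def using assms by (intro eq_equiv_class_iff[OF frac_rel_equiv]) auto
  thus ?thesis using assms by (simp add: frac_rel_def)
qed

lemma frac_eqI:
  assumes "a \<in> carrier R" "s \<in> S" "b \<in> carrier R" "t \<in> S" "t \<otimes> a = s \<otimes> b"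
  shows "frac a s = frac b t"
  using assms S_one by (auto simp: frac_eq_iff)

lemma carrier_L: "carrier L = {frac a s | a s. a \<in> carrier R \<and> s \<in> S}"
  by (auto simp: localization_def quotient_def fraction_def)

lemma frac_closed [simp]: "a \<in> carrier R \<Longrightarrow> s \<in> S \<Longrightarrow> frac a s \<in> carrier L"
  by (auto simp: carrier_L)

lemma one_L: "\<one>\<^bsub>L\<^esub> = frac \<one> \<one>" and zero_L: "\<zero>\<^bsub>L\<^esub> = frac \<zero> \<one>"
  by (simp_all add: localization_def)

text \<open>The union over all representatives in \<open>localization\<close> collapses to one class
  once the operation respects \<open>frac_rel\<close>; by commutativity it suffices to vary one
  argument. Addition is treated in the same way.\<close>

lemma frac_mult:
  assumes "a \<in> carrier R" "s \<in> S" "b \<in> carrier R" "t \<in> S"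
  shows "frac a s \<otimes>\<^bsub>L\<^esub> frac b t = frac (a \<otimes> b) (s \<otimes> t)"
proof -
  have "congruent2 (frac_rel R S) (frac_rel R S) (\<lambda>(a, s) (b, t). frac (a \<otimes> b) (s \<otimes> t))"
  proof (rule congruent2_commuteI[OF frac_rel_equiv])
    fix x y z assume xy: "(x, y) \<in> frac_rel R S" and z: "z \<in> carrier R \<times> S"
    obtain a s b t u where *: "x = (a, s)" "y = (b, t)"
      "a \<in> carrier R" "s \<in> S" "b \<in> carrier R" "t \<in> S" "u \<in> S" "u \<otimes> (t \<otimes> a) = u \<otimes> (s \<otimes> b)"
      using xy by (auto simp: frac_rel_def)
    obtain c w where cw: "z = (c, w)" "c \<in> carrier R" "w \<in> S" using z by auto
    have "u \<otimes> ((w \<otimes> t) \<otimes> (c \<otimes> a)) = w \<otimes> c \<otimes> (u \<otimes> (t \<otimes> a))" using *(3-7) cw by (simp add: m_ac)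
    also have "\<dots> = w \<otimes> c \<otimes> (u \<otimes> (s \<otimes> b))" using *(8) by simp
    also have "\<dots> = u \<otimes> ((w \<otimes> s) \<otimes> (c \<otimes> b))" using *(3-7) cw by (simp add: m_ac)
    finally show "(case z of (a, s) \<Rightarrow> \<lambda>(b, t). frac (a \<otimes> b) (s \<otimes> t)) x =
      (case z of (a, s) \<Rightarrow> \<lambda>(b, t). frac (a \<otimes> b) (s \<otimes> t)) y"
      using * cw S_mult by (auto simp: frac_eq_iff)
  qed (auto simp: m_comm)
  from UN_equiv_class2[OF frac_rel_equiv frac_rel_equiv this, of "(a, s)" "(b, t)"] assms
  show ?thesis by (simp add: localization_def fraction_def case_prod_unfold)
qed

lemma frac_add:
  assumes "a \<in> carrier R" "s \<in> S" "b \<in> carrier R" "t \<in> S"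
  shows "frac a s \<oplus>\<^bsub>L\<^esub> frac b t = frac ((t \<otimes> a) \<oplus> (s \<otimes> b)) (s \<otimes> t)"
proof -
  have "congruent2 (frac_rel R S) (frac_rel R S) (\<lambda>(a, s) (b, t). frac ((t \<otimes> a) \<oplus> (s \<otimes> b)) (s \<otimes> t))"
  proof (rule congruent2_commuteI[OF frac_rel_equiv])
    fix x y z assume xy: "(x, y) \<in> frac_rel R S" and z: "z \<in> carrier R \<times> S"
    obtain a s b t u where *: "x = (a, s)" "y = (b, t)"
      "a \<in> carrier R" "s \<in> S" "b \<in> carrier R" "t \<in> S" "u \<in> S" "u \<otimes> (t \<otimes> a) = u \<otimes> (s \<otimes> b)"
      using xy by (auto simp: frac_rel_def)
    obtain c w where cw: "z = (c, w)" "c \<in> carrier R" "w \<in> S" using z by auto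
    have "u \<otimes> ((w \<otimes> t) \<otimes> ((s \<otimes> c) \<oplus> (w \<otimes> a))) = u \<otimes> w \<otimes> t \<otimes> s \<otimes> c \<oplus> w \<otimes> w \<otimes> (u \<otimes> (t \<otimes> a))"
      using *(3-7) cw by (simp add: m_ac r_distr)
    also have "\<dots> = u \<otimes> w \<otimes> t \<otimes> s \<otimes> c \<oplus> w \<otimes> w \<otimes> (u \<otimes> (s \<otimes> b))" using *(8) by simp
    also have "\<dots> = u \<otimes> ((w \<otimes> s) \<otimes> ((t \<otimes> c) \<oplus> (w \<otimes> b)))"
      using *(3-7) cw by (simp add: m_ac r_distr)
    finally show "(case z of (a, s) \<Rightarrow> \<lambda>(b, t). frac ((t \<otimes> a) \<oplus> (s \<otimes> b)) (s \<otimes> t)) x =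
      (case z of (a, s) \<Rightarrow> \<lambda>(b, t). frac ((t \<otimes> a) \<oplus> (s \<otimes> b)) (s \<otimes> t)) y"
      using * cw S_mult by (auto simp: frac_eq_iff)
  qed (auto simp: m_comm a_comm)
  from UN_equiv_class2[OF frac_rel_equiv frac_rel_equiv this, of "(a, s)" "(b, t)"] assms
  show ?thesis by (simp add: localization_def fraction_def case_prod_unfold)
qed

lemma L_cases:
  assumes "x \<in> carrier L"
  obtains a s where "x = frac a s" "a \<in> carrier R" "s \<in> S"
  using assms by (auto simp: carrier_L)

lemma cring_L: "cring L"
proof (rule cringI)
  show "abelian_group L"
  proof (rule abelian_groupI)
    show "x \<oplus>\<^bsub>L\<^esub> y \<in> carrier L" if "x \<in> carrier L" "y \<in> carrier L" for x y
      using that by (elim L_cases) (simp add: frac_add S_mult)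
    show "(x \<oplus>\<^bsub>L\<^esub> y) \<oplus>\<^bsub>L\<^esub> z = x \<oplus>\<^bsub>L\<^esub> (y \<oplus>\<^bsub>L\<^esub> z)"
      if "x \<in> carrier L" "y \<in> carrier L" "z \<in> carrier L" for x y z
      using that by (elim L_cases) (simp add: frac_add S_mult m_ac a_ac r_distr)
    show "x \<oplus>\<^bsub>L\<^esub> y = y \<oplus>\<^bsub>L\<^esub> x" if "x \<in> carrier L" "y \<in> carrier L" for x y
      using that by (elim L_cases) (simp add: frac_add S_mult m_ac a_ac)
    show "\<zero>\<^bsub>L\<^esub> \<in> carrier L" using S_one by (simp add: zero_L)
    show "\<zero>\<^bsub>L\<^esub> \<oplus>\<^bsub>L\<^esub> x = x" if "x \<in> carrier L" for x
      using that by (elim L_cases) (simp add: zero_L frac_add S_one)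
    show "\<exists>y\<in>carrier L. y \<oplus>\<^bsub>L\<^esub> x = \<zero>\<^bsub>L\<^esub>" if x: "x \<in> carrier L" for x
    proof -
      obtain a s where *: "x = frac a s" "a \<in> carrier R" "s \<in> S" using x by (rule L_cases)
      have "frac (\<ominus> a) s \<oplus>\<^bsub>L\<^esub> x = frac (s \<otimes> \<ominus> a \<oplus> s \<otimes> a) (s \<otimes> s)" using * by (simp add: frac_add)
      also have "s \<otimes> \<ominus> a \<oplus> s \<otimes> a = \<zero>" using * by (simp add: r_distr[symmetric] l_neg)
      also have "frac \<zero> (s \<otimes> s) = \<zero>\<^bsub>L\<^esub>"
        unfolding zero_L by (rule frac_eqI) (use * S_one S_mult in simp_all)
      finally show ?thesis using * by (intro bexI[of _ "frac (\<ominus> a) s"]) auto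
    qed
  qed
  show "comm_monoid L"
  proof (rule comm_monoidI)
    show "x \<otimes>\<^bsub>L\<^esub> y \<in> carrier L" if "x \<in> carrier L" "y \<in> carrier L" for x y
      using that by (elim L_cases) (simp add: frac_mult S_mult)
    show "(x \<otimes>\<^bsub>L\<^esub> y) \<otimes>\<^bsub>L\<^esub> z = x \<otimes>\<^bsub>L\<^esub> (y \<otimes>\<^bsub>L\<^esub> z)"
      if "x \<in> carrier L" "y \<in> carrier L" "z \<in> carrier L" for x y z
      using that by (elim L_cases) (simp add: frac_mult S_mult m_assoc)
    show "x \<otimes>\<^bsub>L\<^esub> y = y \<otimes>\<^bsub>L\<^esub> x" if "x \<in> carrier L" "y \<in> carrier L" for x y
      using that by (elim L_cases) (simp add: frac_mult m_comm)
    show "\<one>\<^bsub>L\<^esub> \<otimes>\<^bsub>L\<^esub> x = x" if "x \<in> carrier L" for x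
      using that by (elim L_cases) (simp add: one_L frac_mult S_one)
    show "\<one>\<^bsub>L\<^esub> \<in> carrier L" using S_one by (simp add: one_L)
  qed
  fix x y z assume "x \<in> carrier L" "y \<in> carrier L" "z \<in> carrier L"
  then obtain a s b t c w where *: "a \<in> carrier R" "s \<in> S" "b \<in> carrier R" "t \<in> S" "c \<in> carrier R" "w \<in> S"
    "x = frac a s" "y = frac b t" "z = frac c w" by (elim L_cases)
  have "(x \<oplus>\<^bsub>L\<^esub> y) \<otimes>\<^bsub>L\<^esub> z = frac ((t \<otimes> a \<oplus> s \<otimes> b) \<otimes> c) (s \<otimes> t \<otimes> w)"
    using * S_mult by (simp add: frac_add frac_mult)
  also have "\<dots> = frac (t \<otimes> w \<otimes> (a \<otimes> c) \<oplus> s \<otimes> w \<otimes> (b \<otimes> c)) (s \<otimes> w \<otimes> (t \<otimes> w))"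
    by (rule frac_eqI) (use * S_mult in \<open>simp_all add: m_ac r_distr l_distr\<close>)
  also have "\<dots> = x \<otimes>\<^bsub>L\<^esub> z \<oplus>\<^bsub>L\<^esub> y \<otimes>\<^bsub>L\<^esub> z"
    using * S_mult by (simp add: frac_add frac_mult)
  finally show "(x \<oplus>\<^bsub>L\<^esub> y) \<otimes>\<^bsub>L\<^esub> z = x \<otimes>\<^bsub>L\<^esub> z \<oplus>\<^bsub>L\<^esub> y \<otimes>\<^bsub>L\<^esub> z" .
qed

definition to_L :: "'a \<Rightarrow> ('a \<times> 'a) set" where "to_L a = frac a \<one>"

lemma to_L_hom: "to_L \<in> ring_hom R L"
  using S_one by (intro ring_hom_memI) (simp_all add: to_L_def frac_mult frac_add one_L)

lemma to_L_ring_hom: "ring_hom_cring R L to_L"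
  by (rule ring_hom_cringI[OF cring_axioms cring_L to_L_hom])

lemma to_L_closed [simp]: "a \<in> carrier R \<Longrightarrow> to_L a \<in> carrier L"
  using S_one by (simp add: to_L_def)

lemma frac_times_denominator:
  assumes "a \<in> carrier R" "s \<in> S" shows "to_L s \<otimes>\<^bsub>L\<^esub> frac a s = to_L a"
proof -
  have "to_L s \<otimes>\<^bsub>L\<^esub> frac a s = frac (s \<otimes> a) (\<one> \<otimes> s)"
    using assms S_one by (simp add: to_L_def frac_mult)
  also have "\<dots> = to_L a" unfolding to_L_def by (rule frac_eqI) (use assms S_one in simp_all)
  finally show ?thesis .
qed

lemma frac_eq_times:
  assumes "a \<in> carrier R" "s \<in> S" shows "frac a s = frac \<one> s \<otimes>\<^bsub>L\<^esub> to_L a"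
  using assms S_one by (simp add: to_L_def frac_mult)

lemma to_L_eq_iff:
  assumes "\<And>s x. s \<in> S \<Longrightarrow> x \<in> carrier R \<Longrightarrow> s \<otimes> x = \<zero> \<Longrightarrow> x = \<zero>" "a \<in> carrier R" "b \<in> carrier R"
  shows "to_L a = to_L b \<longleftrightarrow> a = b"
proof
  assume "to_L a = to_L b"
  then obtain u where u: "u \<in> S" "u \<otimes> a = u \<otimes> b" using assms S_one by (auto simp: to_L_def frac_eq_iff)
  have "u \<otimes> (a \<ominus> b) = u \<otimes> a \<ominus> u \<otimes> b"
    using u(1) assms(2,3) by (simp add: a_minus_def r_distr r_minus)
  also have "\<dots> = \<zero>" using u assms by (simp add: a_minus_def r_neg)
  finally have "a \<ominus> b = \<zero>" using assms u by blast
  thus "a = b" using assms by (simp add: r_right_minus_eq)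
qed simp

end

lemma (in primeideal) mult_set_complement: "mult_set R (carrier R - I)"
proof (unfold_locales)
  show "\<one> \<in> carrier R - I" using one_imp_carrier I_notcarr by auto
  show "s \<otimes> t \<in> carrier R - I" if "s \<in> carrier R - I" "t \<in> carrier R - I" for s t
    using that I_prime by auto
qed auto

text \<open>Primes of \<open>R\<^sub>P\<close> contract to primes of \<open>R\<close> inside \<open>P\<close>, and the contraction is injective.\<close>

lemma (in cring) krull_dim_localization_at_le:
  assumes P: "primeideal P R"
    and ht: "\<And>n Q. (\<And>i. i \<le> n \<Longrightarrow> primeideal (Q i) R) \<Longrightarrow> (\<And>i. i < n \<Longrightarrow> Q i \<subset> Q (Suc i)) \<Longrightarrow>
      Q n \<subseteq> P \<Longrightarrow> n \<le> (k::nat)"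
  shows "krull_dim (localization_at R P) \<le> enat k"
  unfolding krull_dim_def
proof (rule Sup_least)
  interpret mult_set R "carrier R - P" by (rule primeideal.mult_set_complement[OF P])
  fix x assume "x \<in> {enat n |n. \<exists>Q. (\<forall>i\<le>n. primeideal (Q i) (localization_at R P)) \<and> (\<forall>i<n. Q i \<subset> Q (Suc i))}"
  then obtain n Q where x: "x = enat n" and Q: "\<And>i. i \<le> n \<Longrightarrow> primeideal (Q i) L" "\<And>i. i < n \<Longrightarrow> Q i \<subset> Q (Suc i)"
    by (auto simp: localization_at_def)
  define C where "C i = {a \<in> carrier R. to_L a \<in> Q i}" for i
  \<comment> \<open>Denominators are units in the localization, so the contraction
    \<open>C i\<close> determines \<open>Q i\<close>; this keeps the contracted chain
    strict.\<close>
  have C: "to_L a \<in> Q i \<longleftrightarrow> frac a s \<in> Q i" if i: "i \<le> n" and as: "a \<in> carrier R" "s \<in> carrier R - P" for i a s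
  proof -
    have id: "ideal (Q i) L" using Q(1)[OF i] by (rule primeideal.axioms)
    have "frac a s \<in> Q i" if "to_L a \<in> Q i"
      unfolding frac_eq_times[OF as] using as by (intro ideal.I_l_closed[OF id that] frac_closed) auto
    moreover have "to_L a \<in> Q i" if "frac a s \<in> Q i"
      unfolding frac_times_denominator[OF as, symmetric]
      using as by (intro ideal.I_l_closed[OF id that] to_L_closed) auto
    ultimately show ?thesis by blast
  qed
  have "n \<le> k"
  proof (rule ht)
    show "primeideal (C i) R" if "i \<le> n" for i
      unfolding C_def using ring_hom_ring.primeideal_vimage[OF ring_hom_ringI2[OF ring_axioms cring.axioms(1)[OF cring_L] to_L_hom] cring_axioms Q(1)[OF that]] .
    show "C i \<subset> C (Suc i)" if i: "i < n" for i
    proof -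
      obtain z where z: "z \<in> Q (Suc i)" "z \<notin> Q i" using Q(2)[OF i] by blast
      have "z \<in> carrier L"
        using ideal.Icarr[OF primeideal.axioms(1)[OF Q(1)[OF Suc_leI[OF i]]] z(1)] .
      then obtain a s where a: "z = frac a s" "a \<in> carrier R" "s \<in> carrier R - P" by (auto simp: carrier_L)
      have "a \<in> C (Suc i) - C i" using z a C[of "Suc i" a s] C[of i a s] i by (auto simp: C_def)
      moreover have "C i \<subseteq> C (Suc i)" using Q(2)[OF i] by (auto simp: C_def)
      ultimately show ?thesis by blast
    qed
    show "C n \<subseteq> P"
    proof
      fix a assume a: "a \<in> C n"
      show "a \<in> P"
      proof (rule ccontr)
        assume "a \<notin> P"
        hence s: "a \<in> carrier R - P" using a by (auto simp: C_def)
        hence "frac a a \<in> Q n" using C[of n a a] a by (auto simp: C_def)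
        moreover have "frac a a = \<one>\<^bsub>L\<^esub>" unfolding one_L by (rule frac_eqI) (use s S_one in simp_all)
        ultimately have "Q n = carrier L"
          using ideal.one_imp_carrier[OF primeideal.axioms(1)[OF Q(1)[OF order_refl]]] by simp
        thus False using primeideal.I_notcarr[OF Q(1)[OF order_refl]] by simp
      qed
    qed
  qed
  thus "x \<le> enat k" using x by simp
qed

section \<open>Comparison with the localization at the splitting prime\<close>

lemma (in domain) mult_set_nonzero: "mult_set R (carrier R - {\<zero>})"
  by unfold_locales (use integral in auto)

text \<open>The sequence \<open>c n = c 0 (b / a)\<^sup>n\<close> stays in the Noetherian ring \<open>R\<close>, so the ideals
  \<open>(c 0, \<dots>, c (n - 1))\<close> become stationary; this gives a monic equation for \<open>b / a\<close>.\<close>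

lemma (in cring) divides_if_integrally_closed:
  assumes noeth: "noetherian_ring R" and h: "h \<in> ring_hom R D" and D: "integrally_closed_domain D"
    and ab: "a \<in> carrier R" "b \<in> carrier R" "h a \<noteq> \<zero>\<^bsub>D\<^esub>"
    and c: "\<And>n. c n \<in> carrier R" "\<And>n. c n \<otimes> b = c (Suc n) \<otimes> a" "h (c 0) \<noteq> \<zero>\<^bsub>D\<^esub>"
  shows "\<exists>\<alpha>\<in>carrier D. h b = \<alpha> \<otimes>\<^bsub>D\<^esub> h a"
proof -
  interpret D: domain D using D by (simp add: integrally_closed_domain_def)
  interpret F: mult_set D "carrier D - {\<zero>\<^bsub>D\<^esub>}" by (rule D.mult_set_nonzero)
  let ?K = "F.L"
  interpret K: cring ?K by (rule F.cring_L)
  interpret h: ring_hom_cring R D h using h by unfold_locales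
  interpret i: ring_hom_cring D ?K F.to_L by (rule F.to_L_ring_hom)
  define k where "k x = F.to_L (h x)" for x
  have k_closed [simp]: "k x \<in> carrier ?K" if "x \<in> carrier R" for x using that by (simp add: k_def)
  have k_add: "k (x \<oplus> y) = k x \<oplus>\<^bsub>?K\<^esub> k y" if "x \<in> carrier R" "y \<in> carrier R" for x y
    using that by (simp add: k_def)
  have k_mult: "k (x \<otimes> y) = k x \<otimes>\<^bsub>?K\<^esub> k y" if "x \<in> carrier R" "y \<in> carrier R" for x y
    using that by (simp add: k_def)
  have D_nonzero: "\<And>s x. s \<in> carrier D - {\<zero>\<^bsub>D\<^esub>} \<Longrightarrow> x \<in> carrier D \<Longrightarrow> s \<otimes>\<^bsub>D\<^esub> x = \<zero>\<^bsub>D\<^esub> \<Longrightarrow> x = \<zero>\<^bsub>D\<^esub>"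
    using D.integral by blast
  have to_K_inj: "F.to_L x = F.to_L y \<longleftrightarrow> x = y" if "x \<in> carrier D" "y \<in> carrier D" for x y
    by (rule F.to_L_eq_iff[OF _ that]) (rule D_nonzero)
  define \<xi> where "\<xi> = F.frac (h b) (h a)"
  have \<xi>: "\<xi> \<in> carrier ?K" using ab by (simp add: \<xi>_def)
  have \<xi>a: "k a \<otimes>\<^bsub>?K\<^esub> \<xi> = k b" using ab by (simp add: \<xi>_def k_def F.frac_times_denominator)
  have inv: "\<exists>v\<in>carrier ?K. v \<otimes>\<^bsub>?K\<^esub> k x = \<one>\<^bsub>?K\<^esub>" if "x \<in> carrier R" "h x \<noteq> \<zero>\<^bsub>D\<^esub>" for x
  proof -
    have hx: "h x \<in> carrier D" "h x \<in> carrier D - {\<zero>\<^bsub>D\<^esub>}" using that by simp_all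
    have "F.frac \<one>\<^bsub>D\<^esub> (h x) \<otimes>\<^bsub>?K\<^esub> k x = F.frac (h x) (h x)"
      unfolding k_def by (rule F.frac_eq_times[OF hx, symmetric])
    also have "\<dots> = \<one>\<^bsub>?K\<^esub>"
      unfolding F.one_L by (rule F.frac_eqI[OF hx D.one_closed F.S_one]) (use hx in simp)
    finally show ?thesis using F.frac_closed[OF D.one_closed hx(2)] by blast
  qed
  have cancel: "y = z" if *: "k x \<otimes>\<^bsub>?K\<^esub> y = k x \<otimes>\<^bsub>?K\<^esub> z" "x \<in> carrier R" "h x \<noteq> \<zero>\<^bsub>D\<^esub>"
    "y \<in> carrier ?K" "z \<in> carrier ?K" for x y z
  proof -
    obtain v where v: "v \<in> carrier ?K" "v \<otimes>\<^bsub>?K\<^esub> k x = \<one>\<^bsub>?K\<^esub>" using inv[OF *(2,3)] by blast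
    note assoc = K.m_assoc[OF v(1) k_closed[OF *(2)]]
    have "\<one>\<^bsub>?K\<^esub> \<otimes>\<^bsub>?K\<^esub> y = \<one>\<^bsub>?K\<^esub> \<otimes>\<^bsub>?K\<^esub> z"
      unfolding v(2)[symmetric] assoc[OF *(4)] assoc[OF *(5)] *(1) ..
    thus ?thesis using *(4,5) by simp
  qed
  have kc: "k (c n) = k (c 0) \<otimes>\<^bsub>?K\<^esub> \<xi> [^]\<^bsub>?K\<^esub> n" for n
  proof (induction n)
    case 0
    show ?case using c(1) by simp
  next
    case (Suc n)
    have "k a \<otimes>\<^bsub>?K\<^esub> k (c (Suc n)) = k (c n) \<otimes>\<^bsub>?K\<^esub> k b"
      using c(1,2)[of n] c(1)[of "Suc n"] ab by (simp add: k_mult[symmetric] m_comm)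
    also have "\<dots> = (k (c 0) \<otimes>\<^bsub>?K\<^esub> \<xi> [^]\<^bsub>?K\<^esub> n) \<otimes>\<^bsub>?K\<^esub> (k a \<otimes>\<^bsub>?K\<^esub> \<xi>)" using Suc \<xi>a by simp
    also have "\<dots> = k a \<otimes>\<^bsub>?K\<^esub> (k (c 0) \<otimes>\<^bsub>?K\<^esub> \<xi> [^]\<^bsub>?K\<^esub> Suc n)"
      using \<xi> ab c(1)[of 0] by (simp add: K.m_ac)
    finally show ?case by (rule cancel) (use ab c(1) \<xi> in auto)
  qed
  define T where "T = rec_nat {\<zero>} (\<lambda>n U. U <+>\<^bsub>R\<^esub> PIdl (c n))"
  have T_0: "T 0 = {\<zero>}" and T_Suc: "T (Suc n) = T n <+> PIdl (c n)" for n
    by (simp_all add: T_def)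
  have T_ideal: "ideal (T n) R" for n
    by (induction n) (simp_all add: T_0 T_Suc zeroideal add_ideals cgenideal_ideal c(1))
  \<comment> \<open>\<open>T n\<close> is generated by \<open>c 0, ..., c (n - 1)\<close>, so the
    image of \<open>x\<close> is \<open>c 0\<close> times a polynomial in \<open>\<xi>\<close> of
    degree below \<open>n\<close>. The list holds the negated coefficients, highest first; for
    \<open>x = c n\<close> they follow the leading 1 of a monic equation.\<close>
  have T_eval: "\<exists>rs. length rs = n \<and> set rs \<subseteq> k ` carrier R \<and>
      k x \<oplus>\<^bsub>?K\<^esub> k (c 0) \<otimes>\<^bsub>?K\<^esub> K.eval rs \<xi> = \<zero>\<^bsub>?K\<^esub>" if "x \<in> T n" for x n
    using that
  proof (induction n arbitrary: x)
    case 0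
    hence "k x = \<zero>\<^bsub>?K\<^esub>" by (simp add: T_0 k_def)
    thus ?case using c(1)[of 0] by (intro exI[of _ "[]"]) simp
  next
    case (Suc n)
    then obtain v r where v: "v \<in> T n" "r \<in> carrier R" "x = v \<oplus> r \<otimes> c n"
      by (auto simp: T_Suc mem_sum_cgenideal)
    obtain rs where rs: "length rs = n" "set rs \<subseteq> k ` carrier R"
      "k v \<oplus>\<^bsub>?K\<^esub> k (c 0) \<otimes>\<^bsub>?K\<^esub> K.eval rs \<xi> = \<zero>\<^bsub>?K\<^esub>" using Suc.IH[OF v(1)] by blast
    have vc: "v \<in> carrier R" using v(1) idealD(1)[OF T_ideal] by blast
    have kx: "k x = k v \<oplus>\<^bsub>?K\<^esub> k r \<otimes>\<^bsub>?K\<^esub> k (c n)" using v vc c(1) by (simp add: k_add k_mult)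
    have k_neg: "k (\<ominus> r) = \<ominus>\<^bsub>?K\<^esub> k r" using v(2) by (simp add: k_def)
    have ev: "K.eval (k (\<ominus> r) # rs) \<xi> = (\<ominus>\<^bsub>?K\<^esub> k r) \<otimes>\<^bsub>?K\<^esub> \<xi> [^]\<^bsub>?K\<^esub> n \<oplus>\<^bsub>?K\<^esub> K.eval rs \<xi>"
      using rs(1) k_neg by simp
    have E: "K.eval rs \<xi> \<in> carrier ?K" using rs(2) \<xi> by (intro K.eval_in_carrier) auto
    note cl = k_closed[OF v(2)] k_closed[OF vc] k_closed[OF c(1)[of 0]] E K.nat_pow_closed[OF \<xi>, of n]
    have "k x \<oplus>\<^bsub>?K\<^esub> k (c 0) \<otimes>\<^bsub>?K\<^esub> K.eval (k (\<ominus> r) # rs) \<xi>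
        = k v \<oplus>\<^bsub>?K\<^esub> k (c 0) \<otimes>\<^bsub>?K\<^esub> K.eval rs \<xi>"
      unfolding ev kx kc[of n] using cl
      by algebra
    thus ?case using rs v by (intro exI[of _ "k (\<ominus> r) # rs"]) auto
  qed
  have "\<exists>M\<in>range T. \<forall>I\<in>range T. M \<subseteq> I \<longrightarrow> I = M"
  proof (rule noetherian_ring.maximal_ideal_exists[OF noeth])
    show "ideal I R" if "I \<in> range T" for I using that T_ideal by (metis rangeE)
  qed simp
  then obtain n where max: "\<forall>I\<in>range T. T n \<subseteq> I \<longrightarrow> I = T n" by (metis rangeE)
  have n: "T n' = T n" if "T n \<subseteq> T n'" for n' using max that by (metis rangeI)
  have "T (Suc n) = T n"
    unfolding T_Suc by (rule n[of "Suc n", unfolded T_Suc]) (rule sum_upper(1)[OF T_ideal cgenideal_ideal[OF c(1)]])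
  hence "c n \<in> T n"
    using sum_upper(2)[OF T_ideal[of n] cgenideal_ideal[OF c(1)[of n]]] cgenideal_self[OF c(1)[of n]]
    unfolding T_Suc by blast
  then obtain rs where rs: "length rs = n" "set rs \<subseteq> k ` carrier R"
    "k (c n) \<oplus>\<^bsub>?K\<^esub> k (c 0) \<otimes>\<^bsub>?K\<^esub> K.eval rs \<xi> = \<zero>\<^bsub>?K\<^esub>" using T_eval by blast
  have E: "K.eval rs \<xi> \<in> carrier ?K" using rs(2) \<xi> by (intro K.eval_in_carrier) auto
  have ev: "K.eval (\<one>\<^bsub>?K\<^esub> # rs) \<xi> = \<xi> [^]\<^bsub>?K\<^esub> n \<oplus>\<^bsub>?K\<^esub> K.eval rs \<xi>"
    using rs(1) \<xi> by simp
  \<comment> \<open>Substituting \<open>c n = c 0 \<xi>^n\<close> gives \<open>c 0\<close> times the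
    monic polynomial, and \<open>c 0\<close> cancels since its image is nonzero.\<close>
  have "k (c 0) \<otimes>\<^bsub>?K\<^esub> K.eval (\<one>\<^bsub>?K\<^esub> # rs) \<xi> = k (c 0) \<otimes>\<^bsub>?K\<^esub> \<zero>\<^bsub>?K\<^esub>"
    unfolding ev using rs(3) E \<xi> c(1)[of 0] unfolding kc[of n] by (simp add: K.r_distr)
  hence "K.eval (\<one>\<^bsub>?K\<^esub> # rs) \<xi> = \<zero>\<^bsub>?K\<^esub>"
    by (rule cancel) (use c E \<xi> in \<open>auto simp: ev\<close>)
  moreover have "\<one>\<^bsub>?K\<^esub> \<noteq> \<zero>\<^bsub>?K\<^esub>"
    using to_K_inj[OF D.one_closed D.zero_closed] D.one_not_zero by simp
  moreover have "set (\<one>\<^bsub>?K\<^esub> # rs) \<subseteq> F.to_L ` carrier D"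
  proof -
    have "F.to_L \<one>\<^bsub>D\<^esub> \<in> F.to_L ` carrier D" by blast
    moreover have "k ` carrier R \<subseteq> F.to_L ` carrier D" by (auto simp: k_def)
    ultimately show ?thesis using rs(2) by simp
  qed
  ultimately have "integral_over ?K (F.to_L ` carrier D) \<xi>"
    unfolding integral_over_def polynomial_def by (intro exI[of _ "\<one>\<^bsub>?K\<^esub> # rs"]) simp
  moreover have "F.to_L = in_fraction_field D"
    by (rule ext) (simp add: F.to_L_def in_fraction_field_def)
  ultimately have "\<xi> \<in> F.to_L ` carrier D"
    using D \<xi> by (auto simp: integrally_closed_domain_def fraction_field_def)
  then obtain \<alpha> where \<alpha>: "\<alpha> \<in> carrier D" "\<xi> = F.to_L \<alpha>" by blast
  have "F.to_L (h b) = F.to_L (h a \<otimes>\<^bsub>D\<^esub> \<alpha>)" using \<xi>a \<alpha> ab by (simp add: k_def)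
  hence "h b = h a \<otimes>\<^bsub>D\<^esub> \<alpha>" using to_K_inj[of "h b" "h a \<otimes>\<^bsub>D\<^esub> \<alpha>"] \<alpha>(1) ab by simp
  thus ?thesis using \<alpha>(1) ab by (auto simp: D.m_comm)
qed

text \<open>For maps known only through an equation that determines the value, such as
  \<open>t \<psi>(x) = y \<theta>(x)\<close>. Uniqueness of the value makes the chosen function
  \<open>p^(-e)\<close>-linear.\<close>

lemma (in cring) cartier_map_from_relation:
  assumes ex: "\<And>x. x \<in> carrier R \<Longrightarrow> \<exists>z\<in>carrier R. E x z"
    and uniq: "\<And>x z z'. x \<in> carrier R \<Longrightarrow> z \<in> carrier R \<Longrightarrow> z' \<in> carrier R \<Longrightarrow> E x z \<Longrightarrow> E x z' \<Longrightarrow> z = z'"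
    and add: "\<And>x y z w. x \<in> carrier R \<Longrightarrow> y \<in> carrier R \<Longrightarrow> z \<in> carrier R \<Longrightarrow> w \<in> carrier R \<Longrightarrow>
      E x z \<Longrightarrow> E y w \<Longrightarrow> E (x \<oplus> y) (z \<oplus> w)"
    and smult: "\<And>r x z. r \<in> carrier R \<Longrightarrow> x \<in> carrier R \<Longrightarrow> z \<in> carrier R \<Longrightarrow> E x z \<Longrightarrow>
      E (r [^] (p ^ e) \<otimes> x) (r \<otimes> z)"
  shows "\<exists>\<psi>\<in>cartier_maps R p e. \<forall>x\<in>carrier R. E x (\<psi> x)"
proof -
  obtain \<psi> where \<psi>: "\<And>x. x \<in> carrier R \<Longrightarrow> \<psi> x \<in> carrier R \<and> E x (\<psi> x)"
    using ex by metis
  have "\<psi> (x \<oplus> y) = \<psi> x \<oplus> \<psi> y" if "x \<in> carrier R" "y \<in> carrier R" for x y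
    by (rule uniq[of "x \<oplus> y"]) (use \<psi> add that in auto)
  moreover have "\<psi> (r [^] (p ^ e) \<otimes> x) = r \<otimes> \<psi> x" if "r \<in> carrier R" "x \<in> carrier R" for r x
    by (rule uniq[of "r [^] (p ^ e) \<otimes> x"]) (use \<psi> smult that in auto)
  ultimately have "\<psi> \<in> cartier_maps R p e" using \<psi> by (auto simp: cartier_maps_iff)
  thus ?thesis using \<psi> by blast
qed

section \<open>Passing from the localization at the splitting prime back to the ring\<close>

context F_pure_local_ring begin

text \<open>Finite generation of \<open>F^e_*(R)\<close> as a closure principle, so that no sums
  over generators have to be handled later. If \<open>A\<close> generates \<open>F^e_*(R)\<close>
  and \<open>B\<close> generates \<open>F_*(R)\<close>, the products \<open>a^p b\<close> generate
  the next stage: expanding \<open>x\<close> in \<open>A\<close> reaches each \<open>x^p b\<close>,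
  and expanding in \<open>B\<close> then reaches every element.\<close>

lemma F_finite_iterate:
  "\<exists>A. finite A \<and> A \<subseteq> carrier R \<and> (\<forall>T. A \<subseteq> T \<and> \<zero> \<in> T \<and> (\<forall>x\<in>T. \<forall>y\<in>T. x \<oplus> y \<in> T) \<and>
    (\<forall>r\<in>carrier R. \<forall>x\<in>T. r [^] (p ^ e) \<otimes> x \<in> T) \<longrightarrow> carrier R \<subseteq> T)"
proof (induction e)
  case 0
  have "carrier R \<subseteq> T" if T: "\<forall>r\<in>carrier R. \<forall>x\<in>T. r [^] (p ^ 0) \<otimes> x \<in> T" "{\<one>} \<subseteq> T" for T
  proof
    fix r assume "r \<in> carrier R"
    thus "r \<in> T" using T(1)[rule_format, of r \<one>] T(2) by simp
  qed
  thus ?case by (intro exI[of _ "{\<one>}"]) auto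
next
  case (Suc e)
  then obtain A where A: "finite A" "A \<subseteq> carrier R"
    and genA: "\<And>T. A \<subseteq> T \<Longrightarrow> \<zero> \<in> T \<Longrightarrow> (\<And>x y. x \<in> T \<Longrightarrow> y \<in> T \<Longrightarrow> x \<oplus> y \<in> T) \<Longrightarrow>
      (\<And>r x. r \<in> carrier R \<Longrightarrow> x \<in> T \<Longrightarrow> r [^] (p ^ e) \<otimes> x \<in> T) \<Longrightarrow> carrier R \<subseteq> T" by metis
  have fs: "finsum (frobenius_module p 1 R) f A = finsum R f A" for f and A :: "'a set"
    by (simp add: finsum_def finprod_def frobenius_module_def)
  obtain B where B: "finite B" "B \<subseteq> carrier R"
    and genB: "\<And>x. x \<in> carrier R \<Longrightarrow> \<exists>c\<in>B \<rightarrow> carrier R. x = (\<Oplus>b\<in>B. c b [^] p \<otimes> b)"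
    using F_finite unfolding F_finite_def finitely_generated_def fs by (auto simp: frobenius_module_def)
  have gen: "carrier R \<subseteq> T"
    if T: "(\<lambda>(a, b). a [^] p \<otimes> b) ` (A \<times> B) \<subseteq> T" "\<zero> \<in> T" "\<And>x y. x \<in> T \<Longrightarrow> y \<in> T \<Longrightarrow> x \<oplus> y \<in> T"
      "\<And>r x. r \<in> carrier R \<Longrightarrow> x \<in> T \<Longrightarrow> r [^] (p ^ Suc e) \<otimes> x \<in> T" for T
  proof
    have *: "x [^] p \<otimes> b \<in> T" if b: "b \<in> B" and x: "x \<in> carrier R" for x b
    proof -
      have bc: "b \<in> carrier R" using b B by blast
      have "carrier R \<subseteq> {x \<in> carrier R. x [^] p \<otimes> b \<in> T}"
      proof (rule genA)
        show "A \<subseteq> {x \<in> carrier R. x [^] p \<otimes> b \<in> T}" using A b T(1) by auto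
        have "\<zero> [^] p = \<zero>" using p_ge_2 nat_pow_zero[of p] by simp
        thus "\<zero> \<in> {x \<in> carrier R. x [^] p \<otimes> b \<in> T}" using T(2) bc by simp
        show "x \<oplus> y \<in> {x \<in> carrier R. x [^] p \<otimes> b \<in> T}"
          if "x \<in> {x \<in> carrier R. x [^] p \<otimes> b \<in> T}" "y \<in> {x \<in> carrier R. x [^] p \<otimes> b \<in> T}" for x y
          using that T(3)[of "x [^] p \<otimes> b" "y [^] p \<otimes> b"] bc by (simp add: frobenius_add l_distr)
        show "r [^] (p ^ e) \<otimes> x \<in> {x \<in> carrier R. x [^] p \<otimes> b \<in> T}"
          if r: "r \<in> carrier R" and x: "x \<in> {x \<in> carrier R. x [^] p \<otimes> b \<in> T}" for r x
        proof -
          have "(r [^] (p ^ e) \<otimes> x) [^] p \<otimes> b = r [^] (p ^ Suc e) \<otimes> (x [^] p \<otimes> b)"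
            using r x bc by (simp add: nat_pow_distrib nat_pow_pow m_assoc mult.commute)
          thus ?thesis using T(4)[OF r] r x by simp
        qed
      qed
      thus ?thesis using x by blast
    qed
    fix x assume "x \<in> carrier R"
    then obtain c where c: "c \<in> B \<rightarrow> carrier R" "x = (\<Oplus>b\<in>B. c b [^] p \<otimes> b)" using genB by blast
    have "(\<Oplus>b\<in>B'. c b [^] p \<otimes> b) \<in> T" if "finite B'" "B' \<subseteq> B" for B'
      using that
    proof (induction B')
      case (insert b B')
      have "(\<Oplus>b\<in>insert b B'. c b [^] p \<otimes> b) = c b [^] p \<otimes> b \<oplus> (\<Oplus>b\<in>B'. c b [^] p \<otimes> b)"
        using insert B(2) funcset_mem[OF c(1)] by (intro finsum_insert) (auto simp: subset_iff)
      moreover have "c b [^] p \<otimes> b \<in> T" using * insert funcset_mem[OF c(1)] by auto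
      ultimately show ?case using insert T(3) by auto
    qed (use T(2) in simp)
    thus "x \<in> T" using c(2) B(1) by simp
  qed
  show ?case
  proof (intro exI conjI allI impI)
    show "finite ((\<lambda>(a, b). a [^] p \<otimes> b) ` (A \<times> B))" using A B by simp
    show "(\<lambda>(a, b). a [^] p \<otimes> b) ` (A \<times> B) \<subseteq> carrier R" using A B by auto
    show "carrier R \<subseteq> T" if "(\<lambda>(a, b). a [^] p \<otimes> b) ` (A \<times> B) \<subseteq> T \<and> \<zero> \<in> T \<and>
      (\<forall>x\<in>T. \<forall>y\<in>T. x \<oplus> y \<in> T) \<and> (\<forall>r\<in>carrier R. \<forall>x\<in>T. r [^] (p ^ Suc e) \<otimes> x \<in> T)" for T
      by (rule gen) (use that in auto)
  qed
qed

interpretation mult_set R "carrier R - splitting_prime"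
  by (rule primeideal.mult_set_complement[OF splitting_prime_prime])

lemma to_L_inj: "a \<in> carrier R \<Longrightarrow> b \<in> carrier R \<Longrightarrow> to_L a = to_L b \<longleftrightarrow> a = b"
  by (rule to_L_eq_iff) (erule DiffE, rule splitting_prime_nonzerodivisor)

text \<open>A \<open>p\<^sup>-\<^sup>e\<close>-linear map on the localization becomes one on \<open>R\<close> after clearing the denominators
  of its values on finitely many generators of \<open>F\<^sup>e\<^sub>*(R)\<close>.\<close>

lemma splitting_prime_zero_if_localization_strongly_F_regular:
  assumes "strongly_F_regular p (localization_at R splitting_prime)"
  shows "splitting_prime = {\<zero>}"
proof (rule ccontr)
  assume "splitting_prime \<noteq> {\<zero>}"
  moreover have "\<zero> \<in> splitting_prime" by (rule idealD(2)[OF splitting_prime_ideal])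
  ultimately obtain c where c: "c \<in> splitting_prime" "c \<noteq> \<zero>" by auto
  have cc: "c \<in> carrier R" by (rule subsetD[OF idealD(1)[OF splitting_prime_ideal] c(1)])
  interpret h: ring_hom_cring R L to_L by (rule to_L_ring_hom)
  have "to_L c \<noteq> to_L \<zero>" using to_L_inj[OF cc zero_closed] c(2) by blast
  moreover have "to_L \<zero> = \<zero>\<^bsub>L\<^esub>" by (rule h.hom_zero)
  ultimately have "to_L c \<noteq> \<zero>\<^bsub>L\<^esub>" by metis
  then obtain e \<phi> where \<phi>: "\<phi> \<in> cartier_maps L p e" "\<phi> (to_L c) = \<one>\<^bsub>L\<^esub>"
    using assms to_L_closed[OF cc] unfolding strongly_F_regular_def localization_at_def cartier_maps_def
    by blast
  note \<phi>D = cring.cartier_mapsD[OF cring_L \<phi>(1)]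
  obtain A where A: "finite A" "A \<subseteq> carrier R"
    and gen: "\<And>T. A \<subseteq> T \<Longrightarrow> \<zero> \<in> T \<Longrightarrow> (\<And>x y. x \<in> T \<Longrightarrow> y \<in> T \<Longrightarrow> x \<oplus> y \<in> T) \<Longrightarrow>
      (\<And>r x. r \<in> carrier R \<Longrightarrow> x \<in> T \<Longrightarrow> r [^] (p ^ e) \<otimes> x \<in> T) \<Longrightarrow> carrier R \<subseteq> T"
    using F_finite_iterate[of e] by metis
  \<comment> \<open>\<open>E s x z\<close> says that \<open>s\<close> clears the denominator of
    \<open>\<phi> (x/1)\<close>, with result \<open>z\<close>.\<close>
  define E where "E s x z \<longleftrightarrow> to_L s \<otimes>\<^bsub>L\<^esub> \<phi> (to_L x) = to_L z" for s x z
  have E_mult: "E (s' \<otimes> s) x (s' \<otimes> z)"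
    if "E s x z" "s \<in> carrier R" "s' \<in> carrier R" "x \<in> carrier R" "z \<in> carrier R" for s s' x z
    using that \<phi>D(1) by (simp add: E_def h.S.m_assoc)
  have "\<exists>s\<in>carrier R - splitting_prime. \<forall>x\<in>A. \<exists>z\<in>carrier R. E s x z"
    using A
  proof (induction A)
    case empty
    thus ?case using S_one by auto
  next
    case (insert x A)
    then obtain s where s: "s \<in> carrier R - splitting_prime" "\<forall>x\<in>A. \<exists>z\<in>carrier R. E s x z" by blast
    have x: "x \<in> carrier R" using insert by simp
    obtain z w where w: "\<phi> (to_L x) = frac z w" "z \<in> carrier R" "w \<in> carrier R - splitting_prime"
      using L_cases[OF \<phi>D(1)[OF to_L_closed[OF x]]] by blast
    have "E w x z" using w by (simp add: E_def frac_times_denominator)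
    hence 1: "E (s \<otimes> w) x (s \<otimes> z)" using E_mult w s x by blast
    have 2: "\<exists>z\<in>carrier R. E (s \<otimes> w) y z" if "y \<in> A" for y
    proof -
      obtain z where z: "z \<in> carrier R" "E s y z" using s(2) \<open>y \<in> A\<close> by blast
      hence "E (w \<otimes> s) y (w \<otimes> z)" using E_mult[OF z(2)] w s insert.prems \<open>y \<in> A\<close> by blast
      thus ?thesis using w s z m_comm[of w s] by auto
    qed
    show ?case using 1 2 S_mult[OF s(1) w(3)] s w by (intro bexI[of _ "s \<otimes> w"]) auto
  qed
  then obtain s where s: "s \<in> carrier R - splitting_prime" "\<forall>x\<in>A. \<exists>z\<in>carrier R. E s x z" by blast
  have sc: "s \<in> carrier R" using s by simp
  have E_add: "E s (x \<oplus> y) (z \<oplus> w)"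
    if "E s x z" "E s y w" "x \<in> carrier R" "y \<in> carrier R" "z \<in> carrier R" "w \<in> carrier R" for x y z w
    using that sc \<phi>D(1,2) by (simp add: E_def h.S.r_distr)
  have E_smult: "E s (r [^] (p ^ e) \<otimes> x) (r \<otimes> z)"
    if "E s x z" "r \<in> carrier R" "x \<in> carrier R" "z \<in> carrier R" for r x z
  proof -
    have "to_L (r [^] (p ^ e) \<otimes> x) = to_L r [^]\<^bsub>L\<^esub> (p ^ e) \<otimes>\<^bsub>L\<^esub> to_L x"
      using that(2,3) h.hom_mult h.ring.hom_nat_pow nat_pow_closed by metis
    hence *: "\<phi> (to_L (r [^] (p ^ e) \<otimes> x)) = to_L r \<otimes>\<^bsub>L\<^esub> \<phi> (to_L x)"
      using \<phi>D(3)[OF to_L_closed[OF that(2)] to_L_closed[OF that(3)]] by metis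
    have "to_L s \<otimes>\<^bsub>L\<^esub> \<phi> (to_L (r [^] (p ^ e) \<otimes> x)) = to_L r \<otimes>\<^bsub>L\<^esub> (to_L s \<otimes>\<^bsub>L\<^esub> \<phi> (to_L x))"
      unfolding * by (rule h.S.m_lcomm) (use that sc \<phi>D(1) in auto)
    thus ?thesis using that(1) h.hom_mult[OF that(2,4)] unfolding E_def by metis
  qed
  \<comment> \<open>The same \<open>s\<close> works for every \<open>x\<close>: the \<open>x\<close>
    with \<open>s \<phi>(x)\<close> in \<open>R\<close> include the generators and are closed under
    addition and under multiplication by \<open>p^e\<close>-th powers.\<close>
  have "carrier R \<subseteq> {x \<in> carrier R. \<exists>z\<in>carrier R. E s x z}"
  proof (rule gen)
    have "E s \<zero> \<zero>" unfolding E_def h.hom_zero \<phi>D(4) by (rule h.S.r_null[OF to_L_closed[OF sc]])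
    thus "\<zero> \<in> {x \<in> carrier R. \<exists>z\<in>carrier R. E s x z}" by blast
    show "A \<subseteq> {x \<in> carrier R. \<exists>z\<in>carrier R. E s x z}" using A s by blast
    fix x y assume "x \<in> {x \<in> carrier R. \<exists>z\<in>carrier R. E s x z}" "y \<in> {x \<in> carrier R. \<exists>z\<in>carrier R. E s x z}"
    then obtain z w where "x \<in> carrier R" "y \<in> carrier R" "z \<in> carrier R" "w \<in> carrier R" "E s x z" "E s y w"
      by blast
    thus "x \<oplus> y \<in> {x \<in> carrier R. \<exists>z\<in>carrier R. E s x z}"
      using E_add[of x z y w] a_closed by blast
  next
    fix r x assume r: "r \<in> carrier R" and "x \<in> {x \<in> carrier R. \<exists>z\<in>carrier R. E s x z}"
    then obtain z where z: "x \<in> carrier R" "z \<in> carrier R" "E s x z" by blast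
    have "r [^] (p ^ e) \<otimes> x \<in> carrier R" "r \<otimes> z \<in> carrier R" using r z by simp_all
    thus "r [^] (p ^ e) \<otimes> x \<in> {x \<in> carrier R. \<exists>z\<in>carrier R. E s x z}"
      using E_smult[OF z(3) r z(1,2)] by blast
  qed
  hence ex: "\<exists>z\<in>carrier R. E s x z" if "x \<in> carrier R" for x using that by blast
  have "\<exists>\<psi>\<in>cartier_maps R p e. \<forall>x\<in>carrier R. E s x (\<psi> x)"
  proof (rule cartier_map_from_relation[OF ex])
    show "z = z'" if "z \<in> carrier R" "z' \<in> carrier R" "E s x z" "E s x z'" for x z z'
      using that to_L_inj[OF that(1,2)] by (simp add: E_def)
  qed (assumption | (rule E_add E_smult; assumption))+
  then obtain \<psi> where \<psi>: "\<psi> \<in> cartier_maps R p e" "\<And>x. x \<in> carrier R \<Longrightarrow> E s x (\<psi> x)" by blast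
  \<comment> \<open>The resulting map sends \<open>c\<close> to \<open>s\<close>, which is outside
    the splitting prime although \<open>c\<close> is inside.\<close>
  have "to_L (\<psi> c) = to_L s"
    using \<psi>(2)[OF cc] unfolding E_def \<phi>(2) h.S.r_one[OF to_L_closed[OF sc]] by (rule sym)
  hence "\<psi> c = s" using to_L_inj[OF cartier_mapsD(1)[OF \<psi>(1) cc] sc] by blast
  thus False using splitting_prime_compatible[OF \<psi>(1) c(1)] s(1) by blast
qed

text \<open>Let \<open>P\<close> be the splitting prime. If it contains some
  \<open>a \<noteq> 0\<close>, there is a \<open>b'\<close> outside \<open>a R_P\<close> with
  \<open>b' P\<close> inside \<open>(a)\<close>. If \<open>(b'/a) P\<close> is not inside
  \<open>P\<close>, it yields a generator \<open>t\<close> of \<open>P R_P\<close> and a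
  \<open>y\<close> outside \<open>P\<close> such that \<open>y t^(-1) \<pi> (t^(p-1) x)\<close>
  moves \<open>t\<close> out of \<open>P\<close>. If it is inside \<open>P\<close>, then
  \<open>b'/a\<close> is integral over \<open>R_P\<close>, hence in it, which contradicts the choice
  of \<open>b'\<close>.\<close>

lemma splitting_prime_zero_if_height_1_normal:
  assumes normal: "integrally_closed_domain (localization_at R splitting_prime)"
    and ht: "\<And>n Q. (\<And>i. i \<le> n \<Longrightarrow> primeideal (Q i) R) \<Longrightarrow> (\<And>i. i < n \<Longrightarrow> Q i \<subset> Q (Suc i)) \<Longrightarrow>
      Q n \<subseteq> splitting_prime \<Longrightarrow> n \<le> 1"
  shows "splitting_prime = {\<zero>}"
proof (rule ccontr)
  let ?P = splitting_prime
  assume "?P \<noteq> {\<zero>}"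
  moreover have "\<zero> \<in> ?P" by (rule idealD(2)[OF splitting_prime_ideal])
  ultimately obtain a where a: "a \<in> ?P" "a \<noteq> \<zero>" by auto
  note Pc = idealD(1)[OF splitting_prime_ideal]
  have ac: "a \<in> carrier R" using a(1) Pc by blast
  have ic: "integrally_closed_domain L" using normal by (simp add: localization_at_def)
  interpret D: domain L using ic by (simp add: integrally_closed_domain_def)
  interpret h: ring_hom_cring R L to_L by (rule to_L_ring_hom)
  have nonzero: "to_L x \<noteq> \<zero>\<^bsub>L\<^esub>" if "x \<in> carrier R" "x \<noteq> \<zero>" for x
    using to_L_inj[OF that(1) zero_closed] that(2) h.hom_zero by metis
  interpret domain R
  proof (rule domainI[OF cring_axioms])
    show "\<one> \<noteq> \<zero>" using D.one_not_zero h.hom_one h.hom_zero by metis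
    show "x = \<zero> \<or> y = \<zero>" if xy: "x \<otimes> y = \<zero>" "x \<in> carrier R" "y \<in> carrier R" for x y
    proof (rule ccontr)
      assume "\<not> ?thesis"
      hence "to_L x \<noteq> \<zero>\<^bsub>L\<^esub>" "to_L y \<noteq> \<zero>\<^bsub>L\<^esub>" using nonzero xy by blast+
      moreover have "to_L x \<otimes>\<^bsub>L\<^esub> to_L y = \<zero>\<^bsub>L\<^esub>"
        using h.hom_mult[OF xy(2,3)] xy(1) h.hom_zero by metis
      ultimately show False using D.integral xy(2,3) to_L_closed by blast
    qed
  qed
  have prime_eq: "Q = ?P" if Q: "primeideal Q R" "Q \<subseteq> ?P" "x \<in> Q" "x \<noteq> \<zero>" for Q x
  proof (rule ccontr)
    assume "Q \<noteq> ?P"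
    have zero: "{\<zero>} \<subset> Q" using idealD(2)[OF primeideal.axioms(1)[OF Q(1)]] Q(3,4) by blast
    have "2 \<le> (1::nat)"
    proof (rule ht)
      let ?Q = "\<lambda>i. if i = 0 then {\<zero>} else if i = (1::nat) then Q else ?P"
      show "primeideal (?Q i) R" for i using zeroprimeideal Q(1) splitting_prime_prime by simp
      show "?Q i \<subset> ?Q (Suc i)" if "i < 2" for i
        using that zero Q(2) \<open>Q \<noteq> ?P\<close> by (auto simp: less_2_cases_iff)
      show "?Q 2 \<subseteq> ?P" by simp
    qed
    thus False by simp
  qed
  \<comment> \<open>The contraction of \<open>a R_P\<close> to \<open>R\<close>. An associated prime
    of \<open>U\<close> contains \<open>a\<close> and, as \<open>U\<close> is saturated, lies in
    \<open>P\<close>; by the height bound it equals \<open>P\<close>.\<close>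
  define U where "U = {x \<in> carrier R. \<exists>s\<in>carrier R - ?P. s \<otimes> x \<in> PIdl a}"
  note PIa = cgenideal_ideal[OF ac]
  have U_ideal: "ideal U R"
  proof (rule idealI_cring)
    show "U \<subseteq> carrier R" by (auto simp: U_def)
    show "\<zero> \<in> U" using S_one idealD(2)[OF PIa] r_null[OF one_closed] unfolding U_def
      by (intro CollectI conjI bexI[of _ \<one>]) simp_all
    show "x \<oplus> y \<in> U" if xy: "x \<in> U" "y \<in> U" for x y
    proof -
      obtain s t where s: "s \<in> carrier R - ?P" "s \<otimes> x \<in> PIdl a" and t: "t \<in> carrier R - ?P" "t \<otimes> y \<in> PIdl a"
        and xyc: "x \<in> carrier R" "y \<in> carrier R" using xy by (auto simp: U_def)
      have sc: "s \<in> carrier R" "t \<in> carrier R" using s t by auto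
      have "s \<otimes> t \<otimes> (x \<oplus> y) = t \<otimes> (s \<otimes> x) \<oplus> s \<otimes> (t \<otimes> y)" using sc xyc by (simp add: r_distr m_ac)
      also have "\<dots> \<in> PIdl a"
        by (rule idealD(3)[OF PIa idealD(5)[OF PIa sc(2) s(2)] idealD(5)[OF PIa sc(1) t(2)]])
      finally have "s \<otimes> t \<otimes> (x \<oplus> y) \<in> PIdl a" .
      thus ?thesis using S_mult[OF s(1) t(1)] xyc unfolding U_def by blast
    qed
    show "r \<otimes> x \<in> U" if r: "r \<in> carrier R" and x: "x \<in> U" for r x
    proof -
      obtain s where s: "s \<in> carrier R - ?P" "s \<otimes> x \<in> PIdl a" and xc: "x \<in> carrier R"
        using x by (auto simp: U_def)
      have "s \<otimes> (r \<otimes> x) = r \<otimes> (s \<otimes> x)" using s(1) r xc by (intro m_lcomm) auto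
      hence "s \<otimes> (r \<otimes> x) \<in> PIdl a" using idealD(5)[OF PIa r s(2)] by simp
      thus ?thesis using s(1) m_closed[OF r xc] unfolding U_def by blast
    qed
  qed
  have U_sat: "x \<in> U" if x: "x \<in> carrier R" "t \<in> carrier R - ?P" "t \<otimes> x \<in> U" for t x
  proof -
    obtain s where s: "s \<in> carrier R - ?P" "s \<otimes> (t \<otimes> x) \<in> PIdl a" using x(3) unfolding U_def by blast
    have "s \<otimes> t \<otimes> x \<in> PIdl a" using s x by (simp add: m_assoc)
    thus ?thesis using S_mult[OF s(1) x(2)] x(1) unfolding U_def by blast
  qed
  have PIa_P: "PIdl a \<subseteq> ?P" using cgenideal_subset_iff[OF splitting_prime_ideal ac] a(1) by simp
  have "\<one> \<notin> U"
  proof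
    assume "\<one> \<in> U"
    then obtain s where "s \<in> carrier R - ?P" "s \<otimes> \<one> \<in> PIdl a" by (auto simp: U_def)
    thus False using PIa_P by auto
  qed
  hence "U \<noteq> carrier R" by auto
  then obtain b where b: "b \<in> carrier R" "b \<notin> U" and prime: "primeideal (colon U b) R"
    using associated_prime_exists[OF noetherian U_ideal] by blast
  have "colon U b \<subseteq> ?P" using U_sat[OF b(1)] b(2) by (auto simp: colon_def)
  moreover have "a \<in> colon U b"
  proof -
    have "\<one> \<otimes> (a \<otimes> b) \<in> PIdl a" using idealD(6)[OF PIa b(1) cgenideal_self[OF ac]] ac b(1) by simp
    thus ?thesis using S_one ac b(1) unfolding colon_def U_def by blast
  qed
  ultimately have colon_eq: "colon U b = ?P" using prime_eq[OF prime _ _ a(2)] by blast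
  obtain A where A: "A \<subseteq> carrier R" "finite A" "?P = Idl A"
    using noetherian_ring.finetely_gen[OF noetherian splitting_prime_ideal] by blast
  \<comment> \<open>\<open>P b\<close> lies in \<open>U\<close>; multiplying \<open>b\<close> by
    denominators for finitely many generators of \<open>P\<close> moves their products with it into
    \<open>(a)\<close> itself.\<close>
  have "\<exists>s\<in>carrier R - ?P. \<forall>x\<in>A. x \<otimes> (s \<otimes> b) \<in> PIdl a"
  proof -
    have "A \<subseteq> ?P" using A genideal_self by simp
    with A(2) show ?thesis
    proof (induction A)
      case empty
      thus ?case using S_one by blast
    next
      case (insert x A)
      then obtain s where s: "s \<in> carrier R - ?P" "\<forall>x\<in>A. x \<otimes> (s \<otimes> b) \<in> PIdl a" by auto
      have "x \<in> colon U b" using insert colon_eq by simp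
      then obtain t where t: "t \<in> carrier R - ?P" "t \<otimes> (x \<otimes> b) \<in> PIdl a" and xc: "x \<in> carrier R"
        by (auto simp: colon_def U_def)
      have sc: "s \<in> carrier R" "t \<in> carrier R" using s t by auto
      have "x \<otimes> (s \<otimes> t \<otimes> b) = s \<otimes> (t \<otimes> (x \<otimes> b))" using sc xc b(1) by (simp add: m_ac)
      hence 1: "x \<otimes> (s \<otimes> t \<otimes> b) \<in> PIdl a" using idealD(5)[OF PIa sc(1) t(2)] by simp
      have 2: "y \<otimes> (s \<otimes> t \<otimes> b) \<in> PIdl a" if "y \<in> A" for y
      proof -
        have yc: "y \<in> carrier R" using \<open>y \<in> A\<close> insert.prems Pc by blast
        have "y \<otimes> (s \<otimes> t \<otimes> b) = t \<otimes> (y \<otimes> (s \<otimes> b))" using sc yc b(1) by (simp add: m_ac)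
        moreover have "y \<otimes> (s \<otimes> b) \<in> PIdl a" using s(2) \<open>y \<in> A\<close> by blast
        ultimately show ?thesis using idealD(5)[OF PIa sc(2)] by simp
      qed
      show ?case using 1 2 S_mult[OF s(1) t(1)] by blast
    qed
  qed
  then obtain s where s: "s \<in> carrier R - ?P" "\<And>x. x \<in> A \<Longrightarrow> x \<otimes> (s \<otimes> b) \<in> PIdl a" by blast
  define b' where "b' = s \<otimes> b"
  have b': "b' \<in> carrier R" "b' \<notin> U" using s(1) b U_sat[OF b(1) s(1)] by (auto simp: b'_def)
  have "?P \<subseteq> colon (PIdl a) b'"
    unfolding A(3) by (rule genideal_minimal[OF colon_ideal[OF PIa b'(1)]]) (use s(2) A(1) in \<open>auto simp: colon_def b'_def\<close>)
  hence ex: "\<exists>y\<in>carrier R. x \<otimes> b' = y \<otimes> a" if "x \<in> ?P" for x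
    using that by (auto simp: colon_def cgenideal_def)
  show False
  proof (cases "\<exists>t\<in>?P. \<exists>y\<in>carrier R - ?P. t \<otimes> b' = y \<otimes> a")
    case True
    then obtain t y where t: "t \<in> ?P" and y: "y \<in> carrier R - ?P" and ty: "t \<otimes> b' = y \<otimes> a" by blast
    have tc: "t \<in> carrier R" and yc: "y \<in> carrier R" using t y Pc by auto
    have "y \<noteq> \<zero>" using y idealD(2)[OF splitting_prime_ideal] by auto
    hence t0: "t \<noteq> \<zero>" using ty integral[of y a] yc ac a(2) b'(1) by auto
    \<comment> \<open>Up to the unit \<open>y\<close> of \<open>R_P\<close>, every element of
      \<open>P\<close> is a multiple of \<open>t\<close>: \<open>x b' = z a\<close> and
      \<open>t b' = y a\<close> give \<open>x y = t z\<close> after cancelling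
      \<open>a\<close>.\<close>
    have div_t: "\<exists>z\<in>carrier R. x \<otimes> y = t \<otimes> z" if x: "x \<in> ?P" for x
    proof -
      have xc: "x \<in> carrier R" using x Pc by blast
      obtain z where z: "z \<in> carrier R" "x \<otimes> b' = z \<otimes> a" using ex[OF x] by blast
      have "a \<otimes> (x \<otimes> y) = x \<otimes> (y \<otimes> a)" using ac xc yc by (simp add: m_ac)
      also have "\<dots> = t \<otimes> (x \<otimes> b')" unfolding ty[symmetric] by (rule m_lcomm[OF xc tc b'(1)])
      also have "\<dots> = a \<otimes> (t \<otimes> z)" unfolding z(2) using ac tc z(1) by (simp add: m_ac)
      finally have "x \<otimes> y = t \<otimes> z" using m_lcancel[OF a(2) ac] xc yc tc z(1) by simp
      thus ?thesis using z(1) by blast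
    qed
    obtain \<pi> where \<pi>: "\<pi> \<in> cartier_maps R p 1" "\<And>x. x \<in> carrier R \<Longrightarrow> \<pi> (x [^] p) = x"
      using frobenius_splitting by blast
    let ?u = "t [^] (p - 1)"
    \<comment> \<open>The exponent is positive because \<open>p \<ge> 2\<close>. Hence
      \<open>\<pi> (?u x)\<close> stays in \<open>P\<close>, where division by \<open>t\<close> is
      possible after multiplication by \<open>y\<close>.\<close>
    have u: "?u \<in> ?P"
    proof -
      have "?u = t \<otimes> t [^] (p - 2)"
        using tc p_ge_2 nat_pow_Suc2[OF tc, of "p - 2"] by (simp add: Suc_diff_le eval_nat_numeral Suc_diff_Suc)
      thus ?thesis using idealD(6)[OF splitting_prime_ideal _ t] tc by simp
    qed
    have uc: "?u \<in> carrier R" using tc by simp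
    define \<theta> where "\<theta> x = \<pi> (?u \<otimes> x)" for x
    have \<theta>: "\<theta> \<in> cartier_maps R p 1" unfolding \<theta>_def by (rule cartier_maps_premult[OF \<pi>(1) uc])
    note \<theta>D = cartier_mapsD[OF \<theta>]
    have "\<exists>\<psi>\<in>cartier_maps R p 1. \<forall>x\<in>carrier R. \<theta> x \<otimes> y = t \<otimes> \<psi> x"
    proof (rule cartier_map_from_relation)
      show "\<exists>z\<in>carrier R. \<theta> x \<otimes> y = t \<otimes> z" if x: "x \<in> carrier R" for x
        using div_t[OF splitting_prime_compatible[OF \<pi>(1) idealD(6)[OF splitting_prime_ideal x u]]]
        unfolding \<theta>_def .
      show "z = z'" if "z \<in> carrier R" "z' \<in> carrier R" "\<theta> x \<otimes> y = t \<otimes> z" "\<theta> x \<otimes> y = t \<otimes> z'" for x z z'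
        using m_lcancel[OF t0 tc that(1,2)] that(3,4) by metis
      show "\<theta> (x \<oplus> x') \<otimes> y = t \<otimes> (z \<oplus> z')"
        if "x \<in> carrier R" "x' \<in> carrier R" "z \<in> carrier R" "z' \<in> carrier R" "\<theta> x \<otimes> y = t \<otimes> z" "\<theta> x' \<otimes> y = t \<otimes> z'"
        for x x' z z'
        unfolding \<theta>D(2)[OF that(1,2)] l_distr[OF \<theta>D(1)[OF that(1)] \<theta>D(1)[OF that(2)] yc] that(5,6)
        by (rule r_distr[OF that(3,4) tc, symmetric])
      show "\<theta> (r [^] (p ^ 1) \<otimes> x) \<otimes> y = t \<otimes> (r \<otimes> z)"
        if "r \<in> carrier R" "x \<in> carrier R" "z \<in> carrier R" "\<theta> x \<otimes> y = t \<otimes> z" for r x z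
        unfolding \<theta>D(3)[OF that(1,2)] m_assoc[OF that(1) \<theta>D(1)[OF that(2)] yc] that(4)
        by (rule m_lcomm[OF that(1) tc that(3)])
    qed
    then obtain \<psi> where \<psi>: "\<psi> \<in> cartier_maps R p 1" "\<And>x. x \<in> carrier R \<Longrightarrow> \<theta> x \<otimes> y = t \<otimes> \<psi> x" by blast
    have "?u \<otimes> t = t [^] p" using pow_p_pow[OF tc, of 1] by simp
    hence "\<theta> t = t" using \<pi>(2)[OF tc] by (simp add: \<theta>_def)
    hence "t \<otimes> y = t \<otimes> \<psi> t" using \<psi>(2)[OF tc] by simp
    hence "\<psi> t = y" using m_lcancel[OF t0 tc yc cartier_mapsD(1)[OF \<psi>(1) tc]] by simp
    thus False using splitting_prime_compatible[OF \<psi>(1) t] y by simp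
  next
    case False
    have "\<exists>y\<in>?P. x \<otimes> b' = y \<otimes> a" if "x \<in> ?P" for x using False ex[OF that] that by blast
    then obtain g where g: "\<And>x. x \<in> ?P \<Longrightarrow> g x \<in> ?P" "\<And>x. x \<in> ?P \<Longrightarrow> x \<otimes> b' = g x \<otimes> a" by metis
    \<comment> \<open>\<open>g\<close> is multiplication by \<open>b'/a\<close> on \<open>P\<close>,
      so \<open>c n = a (b'/a)^n\<close> never leaves \<open>P\<close>.\<close>
    define c where "c n = (g ^^ n) a" for n
    have c: "c n \<in> ?P" for n by (induction n) (simp_all add: c_def a(1) g(1))
    have "\<exists>\<alpha>\<in>carrier L. to_L b' = \<alpha> \<otimes>\<^bsub>L\<^esub> to_L a"
    proof (rule divides_if_integrally_closed[OF noetherian to_L_hom ic ac b'(1) nonzero[OF ac a(2)]])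
      show "c n \<in> carrier R" for n using c Pc by blast
      show "c n \<otimes> b' = c (Suc n) \<otimes> a" for n using g(2)[OF c[of n]] by (simp add: c_def)
      show "to_L (c 0) \<noteq> \<zero>\<^bsub>L\<^esub>" using nonzero[OF ac a(2)] by (simp add: c_def)
    qed
    then obtain x t where xt: "x \<in> carrier R" "t \<in> carrier R - ?P" "to_L b' = frac x t \<otimes>\<^bsub>L\<^esub> to_L a"
      by (auto elim: L_cases)
    have tc: "t \<in> carrier R" using xt(2) by simp
    have "to_L t \<otimes>\<^bsub>L\<^esub> to_L b' = to_L x \<otimes>\<^bsub>L\<^esub> to_L a"
      unfolding xt(3) frac_times_denominator[OF xt(1,2), symmetric]
      by (rule D.m_assoc[OF to_L_closed[OF tc] frac_closed[OF xt(1,2)] to_L_closed[OF ac], symmetric])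
    hence "to_L (t \<otimes> b') = to_L (x \<otimes> a)" using h.hom_mult tc xt(1) b'(1) ac by metis
    hence "t \<otimes> b' = x \<otimes> a"
      using to_L_inj[OF m_closed[OF tc b'(1)] m_closed[OF xt(1) ac]] by blast
    hence "t \<otimes> b' \<in> PIdl a" using xt(1) by (auto simp: cgenideal_def)
    thus False using b' xt(2) unfolding U_def by blast
  qed
qed

end

section \<open>Strong F-regularity from the height of the splitting prime\<close>

theorem proposition2p21:
  fixes R :: "('a, 'b) ring_scheme" and m :: "'a set" and p :: nat
  assumes "noetherian_ring R" and "local_ring R m"
    and "prime p" and "has_characteristic R p"
    and "F_finite p R" and "F_pure p R"
  shows "((\<exists>k::nat. k > 0 \<and> dfpt p R m < ereal (real k + 1) \<and>
            (\<forall>P. primeideal P R \<and> krull_dim (localization_at R P) \<le> enat k \<longrightarrow>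
                 strongly_F_regular p (localization_at R P)))
          \<longrightarrow> strongly_F_regular p R) \<and>
         (dfpt p R m < 2 \<and> normal_ring R \<longrightarrow> strongly_F_regular p R)"
proof -
  interpret cring R using assms(2) by (simp add: local_ring_def)
  interpret F_pure_local_ring R m p 
    by (intro F_pure_local_ring.intro noetherian_local_ring.intro noetherian_local_ring_axioms.intro
        F_pure_local_ring_axioms.intro cring_axioms assms)
  show ?thesis
  proof (intro conjI impI)
    assume "\<exists>k::nat. k > 0 \<and> dfpt p R m < ereal (real k + 1) \<and>
      (\<forall>P. primeideal P R \<and> krull_dim (localization_at R P) \<le> enat k \<longrightarrow> strongly_F_regular p (localization_at R P))"
    then obtain k :: nat where k: "dfpt p R m < ereal (real k + 1)"
      "\<And>P. primeideal P R \<Longrightarrow> krull_dim (localization_at R P) \<le> enat k \<Longrightarrow> strongly_F_regular p (localization_at R P)"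
      by blast
    have "krull_dim (localization_at R splitting_prime) \<le> enat k"
      by (rule krull_dim_localization_at_le[OF splitting_prime_prime height_splitting_prime_le[OF k(1)]])
    from k(2)[OF splitting_prime_prime this] show "strongly_F_regular p R"
      by (intro strongly_F_regular_if_splitting_prime_zero splitting_prime_zero_if_localization_strongly_F_regular)
  next
    assume "dfpt p R m < 2 \<and> normal_ring R"
    \<comment> \<open>The case \<open>k = 1\<close>: the splitting prime has height at most 1, and
      normality is applied at this prime.\<close>
    hence "dfpt p R m < ereal (real 1 + 1)" "integrally_closed_domain (localization_at R splitting_prime)"
      using splitting_prime_prime by (simp_all add: normal_ring_def)
    thus "strongly_F_regular p R"
      by (intro strongly_F_regular_if_splitting_prime_zero splitting_prime_zero_if_height_1_normal
          height_splitting_prime_le)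
  qed
qed

end
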